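(* Consider an execution of the DRL transition system, and let $Q$ be a finalized set of snapshots, all taken at or before time $t_f$. Then every actor that has a snapshot in $Q$ is terminated at time $t_f$.
   Context: DRL transition system. Refobs are triples $x: A\to B$ (owner $A$, target $B$, unique token $x$). Facts: $\mathrm{Created}(x)$, $\mathrm{Released}(x)$, $\mathrm{CreatedUsing}(x,y)$, $\mathrm{Activated}(x)$, $\mathrm{Unreleased}(x)$, $\mathrm{SentCount}(x,n)$, $\mathrm{RecvCount}(x,n)$. For a knowledge set (finite set of facts) $\Phi$, $\Phi\vdash\phi$ means derivability in first-order logic plus: absent any $\mathrm{SentCount}(x,n)$, $\Phi\vdash\mathrm{SentCount}(x,0)$; likewise $\mathrm{RecvCount}$; $\Phi\vdash\mathrm{Created}(x)\wedge\neg\mathrm{Released}(x)$ implies $\Phi\vdash\mathrm{Unreleased}(x)$; $\Phi\vdash\mathrm{CreatedUsing}(x,y)$ implies $\Phi\vdash\mathrm{Created}(y)$. Configurations $(\alpha,\mu,\rho,\chi)$: $\alpha$ maps internal actors to knowledge sets (busy or idle), $\mu$ maps actors to multisets of undelivered messages ($\mathrm{app}(x,R)$, $\mathrm{info}(y,z,B)$, $\mathrm{release}(x,n)$), $\rho\subseteq\mathrm{dom}(\alpha)$ receptionists, $\chi$ external actors. Initial configuration: one busy actor $A$ with $\{\mathrm{Activated}(x:A\to E),\mathrm{Created}(y:A\to A),\mathrm{Activated}(y:A\to A)\}$, no messages, $\rho=\emptyset$, $\chi=\{E\}$. Rules: Spawn (busy $A$ spawns fresh $B$ with fresh $x,y$: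 $A$ adds $\mathrm{Activated}(x:A\to B)$, $B$ starts busy with $\{\mathrm{Created}(x),\mathrm{Created}(y:B\to B),\mathrm{Activated}(y)\}$); Send (busy $A$ with $\Phi\vdash\mathrm{Activated}(x:A\to B)$ and $\Phi\vdash\mathrm{Activated}(y_i:A\to C_i)$ and fresh $z_i$: increments send count of $x$, adds $\mathrm{CreatedUsing}(y_i,z_i)$, sends $\mathrm{app}(x,\{z_i:B\to C_i\})$ to $B$); Receive (idle $B$ consumes $\mathrm{app}(x,R)$, becomes busy, increments receive count of $x$, adds $\mathrm{Activated}(z)$ for $z\in R$); Idle (busy becomes idle); SendInfo (busy $A$ removes $\mathrm{CreatedUsing}(y:A\to C,z:B\to C)$, increments send count of $y$, sends $\mathrm{info}(y,z,B)$ to $C$); Info (idle $C$ consumes it, increments receive count of $y$, adds $\mathrm{Created}(z)$); SendRelease (busy $A$ with $\mathrm{Activated}(x:A\to B),\mathrm{SentCount}(x,n)$ and no $\mathrm{CreatedUsing}(x,\cdot)$ removes both facts, deactivating $x$, and sends $\mathrm{release}(x,n)$ to $B$); Release (idle $B$ with $\Phi\vdash\mathrm{RecvCount}(x,n)$ consumes $\mathrm{release}(x,n)$, adds $\mathrm{Released}(x)$, releasing $x$); Compaction (idle $C$ removes $\mathrm{Created}(x)$, $\mathrm{Released}(x)$, $\mathrm{RecvCount}(x,\cdot)$); Snapshot (an idle actor's current knowledge set is recorded as its snapshot); In (a receptionist receives $\mathrm{app}(\bot,R)$ from outside, with fresh refobs it owns whose targets are receptionists or external); Out ($\mathrm{app}$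 messages to external actors are delivered; internal targets of contained refobs become receptionists); ReleaseOut/InfoOut drop control messages to external actors. An execution is a sequence of steps $\kappa_0\to\kappa_1\to\cdots$ from the initial configuration; time $t$ refers to $\kappa_t$. An actor can potentially receive a message in $\kappa$ if some sequence of events (possibly empty) from $\kappa$ leads to a configuration where it has an undelivered message; it is terminated if it is idle and cannot potentially receive a message. A set of snapshots $Q$ has at most one snapshot $\Phi_A$ per actor $A$; write $A\in Q$ if $A$ has a snapshot in $Q$, and $Q\vdash\phi$ if $\Phi\vdash\phi$ for some $\Phi\in Q$. $Q$ is closed if whenever $Q\vdash\mathrm{Unreleased}(x:A\to B)$ and $B\in Q$, then $A\in Q$ and $\Phi_A\vdash\mathrm{Activated}(x)$. $B\in Q$ appears blocked if for every $x:A\to B$ with $Q\vdash\mathrm{Unreleased}(x)$, we have $A,B\in Q$ and $\Phi_A\vdash\mathrm{SentCount}(x,n)$, $\Phi_B\vdash\mathrm{RecvCount}(x,n)$ for some $n$. $Q$ is finalized if it is closed and every actor in $Q$ appears blocked. *)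

theory Defs
  imports Main "HOL-Library.Multiset" "HOL-Library.Extended_Nat"
begin

text \<open>Actor names range over \<open>'a\<close> and refob tokens over \<open>'t\<close>. A refob carries its token, owner and target.\<close>

datatype ('t, 'a) refob = Refob (token: 't) (owner: 'a) (target: 'a)

datatype ('t, 'a) fact =
    Created "('t, 'a) refob"
  | Released "('t, 'a) refob"
  | CreatedUsing "('t, 'a) refob" "('t, 'a) refob"
  | Activated "('t, 'a) refob"
  | Unreleased "('t, 'a) refob"
  | SentCount "('t, 'a) refob" nat
  | RecvCount "('t, 'a) refob" nat

type_synonym ('t, 'a) knowledge = "('t, 'a) fact set"

text \<open>A knowledge set is a set of atomic facts, so the atomic consequences of plain first-order
  logic are its members. Negation is read under the closed-world assumption: \<open>\<Phi>\<close> entails that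
  \<open>x\<close> is not released iff \<open>Released x\<close> is not derivable, and \<open>Released x\<close> is
  derivable only by membership.\<close>

inductive entails :: "('t, 'a) knowledge \<Rightarrow> ('t, 'a) fact \<Rightarrow> bool" (infix "\<turnstile>" 50)
  for \<Phi> :: "('t, 'a) knowledge" where
  member: "\<phi> \<in> \<Phi> \<Longrightarrow> \<Phi> \<turnstile> \<phi>"
| sent_zero: "(\<And>n. SentCount x n \<notin> \<Phi>) \<Longrightarrow> \<Phi> \<turnstile> SentCount x 0"
| recv_zero: "(\<And>n. RecvCount x n \<notin> \<Phi>) \<Longrightarrow> \<Phi> \<turnstile> RecvCount x 0"
| unreleased: "\<Phi> \<turnstile> Created x \<Longrightarrow> Released x \<notin> \<Phi> \<Longrightarrow> \<Phi> \<turnstile> Unreleased x"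
| created: "\<Phi> \<turnstile> CreatedUsing x y \<Longrightarrow> \<Phi> \<turnstile> Created y"

definition inc_sent :: "('t, 'a) refob \<Rightarrow> ('t, 'a) knowledge \<Rightarrow> ('t, 'a) knowledge" where
  "inc_sent x \<Phi> = (\<Phi> - {SentCount x n | n. True}) \<union> {SentCount x (Suc n) | n. \<Phi> \<turnstile> SentCount x n}"

definition inc_recv :: "('t, 'a) refob \<Rightarrow> ('t, 'a) knowledge \<Rightarrow> ('t, 'a) knowledge" where
  "inc_recv x \<Phi> = (\<Phi> - {RecvCount x n | n. True}) \<union> {RecvCount x (Suc n) | n. \<Phi> \<turnstile> RecvCount x n}"

text \<open>In \<open>App\<close>, \<open>None\<close> stands for the absent refob \<open>\<bottom>\<close> of messages arriving from outside;
  such a message changes no receive count.\<close>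

datatype ('t, 'a) message =
    App "('t, 'a) refob option" "('t, 'a) refob set"
  | InfoMsg "('t, 'a) refob" "('t, 'a) refob" 'a
  | ReleaseMsg "('t, 'a) refob" nat

datatype ('t, 'a) local_state =
    BusyWith "('t, 'a) knowledge"
  | IdleWith "('t, 'a) knowledge"

fun state_facts :: "('t, 'a) local_state \<Rightarrow> ('t, 'a) knowledge" where
  "state_facts (BusyWith \<Phi>) = \<Phi>"
| "state_facts (IdleWith \<Phi>) = \<Phi>"

record ('t, 'a) config =
  actors :: "'a \<rightharpoonup> ('t, 'a) local_state"
  msgs :: "'a \<Rightarrow> ('t, 'a) message multiset"
  receptionists :: "'a set"
  externals :: "'a set"

fun fact_refobs :: "('t, 'a) fact \<Rightarrow> ('t, 'a) refob set" where
  "fact_refobs (Created x) = {x}"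
| "fact_refobs (Released x) = {x}"
| "fact_refobs (CreatedUsing x y) = {x, y}"
| "fact_refobs (Activated x) = {x}"
| "fact_refobs (Unreleased x) = {x}"
| "fact_refobs (SentCount x n) = {x}"
| "fact_refobs (RecvCount x n) = {x}"

fun message_refobs :: "('t, 'a) message \<Rightarrow> ('t, 'a) refob set" where
  "message_refobs (App w R) = set_option w \<union> R"
| "message_refobs (InfoMsg y z B) = {y, z}"
| "message_refobs (ReleaseMsg x n) = {x}"

definition tokens :: "('t, 'a) config \<Rightarrow> 't set" where
  "tokens \<kappa> = token ` ((\<Union>s \<in> ran (actors \<kappa>). \<Union>\<phi> \<in> state_facts s. fact_refobs \<phi>)
                     \<union> (\<Union>A. \<Union>m \<in> set_mset (msgs \<kappa> A). message_refobs m))"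

definition set_actor :: "'a \<Rightarrow> ('t, 'a) local_state \<Rightarrow> ('t, 'a) config \<Rightarrow> ('t, 'a) config" where
  "set_actor A s \<kappa> = \<kappa>\<lparr>actors := (actors \<kappa>)(A \<mapsto> s)\<rparr>"

definition post :: "'a \<Rightarrow> ('t, 'a) message \<Rightarrow> ('t, 'a) config \<Rightarrow> ('t, 'a) config" where
  "post B m \<kappa> = \<kappa>\<lparr>msgs := (msgs \<kappa>)(B := add_mset m (msgs \<kappa> B))\<rparr>"

definition consume :: "'a \<Rightarrow> ('t, 'a) message \<Rightarrow> ('t, 'a) config \<Rightarrow> ('t, 'a) config" where
  "consume B m \<kappa> = \<kappa>\<lparr>msgs := (msgs \<kappa>)(B := msgs \<kappa> B - {#m#})\<rparr>"

text \<open>In \<open>Send\<close>, the list holds the pairs \<open>(y\<^sub>i, z\<^sub>i)\<close>.\<close>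

datatype ('t, 'a) event =
    Spawn 'a 'a "('t, 'a) refob" "('t, 'a) refob"
  | Send 'a "('t, 'a) refob" "(('t, 'a) refob \<times> ('t, 'a) refob) list"
  | Receive 'a "('t, 'a) refob option" "('t, 'a) refob set"
  | Idle 'a
  | SendInfo 'a "('t, 'a) refob" "('t, 'a) refob"
  | Info 'a "('t, 'a) refob" "('t, 'a) refob" 'a
  | SendRelease 'a "('t, 'a) refob" nat
  | Release 'a "('t, 'a) refob" nat
  | Compaction 'a "('t, 'a) refob"
  | Snapshot 'a "('t, 'a) knowledge"
  | In 'a "('t, 'a) refob set"
  | Out 'a "('t, 'a) refob option" "('t, 'a) refob set"
  | ReleaseOut 'a "('t, 'a) refob" nat
  | InfoOut 'a "('t, 'a) refob" "('t, 'a) refob" 'a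

text \<open>The parameter \<open>U\<close> of a step is the set of tokens already used: compaction and release erase
  refobs from a configuration, so a token absent from the current configuration need not be fresh.
  For actor names no such history is needed, since internal and external actors never disappear.

  Counts are tested with \<open>\<turnstile>\<close>, so a count that has never been incremented is \<open>0\<close>; in particular
  a refob that was never used can be deactivated and its facts compacted.

  In rule \<open>in\<close>, targets of incoming refobs that are not internal are external actors, possibly
  mentioned for the first time.\<close>

inductive step :: "'t set \<Rightarrow> ('t, 'a) config \<Rightarrow> ('t, 'a) event \<Rightarrow> ('t, 'a) config \<Rightarrow> bool"
  for U :: "'t set" and \<kappa> :: "('t, 'a) config" where
  spawn:
    "step U \<kappa> (Spawn A B x y)
       (set_actor A (BusyWith (\<Phi> \<union> {Activated x}))
         (set_actor B (BusyWith {Created x, Created y, Activated y}) \<kappa>))"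
  if "actors \<kappa> A = Some (BusyWith \<Phi>)" "B \<notin> dom (actors \<kappa>) \<union> externals \<kappa>"
     "owner x = A" "target x = B" "owner y = B" "target y = B"
     "token x \<notin> U" "token y \<notin> U" "token x \<noteq> token y"
| send:
    "step U \<kappa> (Send A x yzs)
       (post (target x) (App (Some x) (snd ` set yzs))
         (set_actor A (BusyWith (inc_sent x \<Phi> \<union> {CreatedUsing y z | y z. (y, z) \<in> set yzs})) \<kappa>))"
  if "actors \<kappa> A = Some (BusyWith \<Phi>)" "\<Phi> \<turnstile> Activated x" "owner x = A"
     "\<forall>(y, z) \<in> set yzs. \<Phi> \<turnstile> Activated y \<and> owner y = A
        \<and> owner z = target x \<and> target z = target y \<and> token z \<notin> U"
     "distinct (map (\<lambda>(y, z). token z) yzs)"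
| receive:
    "step U \<kappa> (Receive B w R)
       (consume B (App w R)
         (set_actor B (BusyWith ((case w of None \<Rightarrow> \<Phi> | Some x \<Rightarrow> inc_recv x \<Phi>) \<union> Activated ` R)) \<kappa>))"
  if "actors \<kappa> B = Some (IdleWith \<Phi>)" "App w R \<in># msgs \<kappa> B"
| idle:
    "step U \<kappa> (Idle A) (set_actor A (IdleWith \<Phi>) \<kappa>)"
  if "actors \<kappa> A = Some (BusyWith \<Phi>)"
| send_info:
    "step U \<kappa> (SendInfo A y z)
       (post (target y) (InfoMsg y z (owner z))
         (set_actor A (BusyWith (inc_sent y (\<Phi> - {CreatedUsing y z}))) \<kappa>))"
  if "actors \<kappa> A = Some (BusyWith \<Phi>)" "CreatedUsing y z \<in> \<Phi>" "owner y = A" "target z = target y"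
| info:
    "step U \<kappa> (Info C y z B)
       (consume C (InfoMsg y z B) (set_actor C (IdleWith (inc_recv y \<Phi> \<union> {Created z})) \<kappa>))"
  if "actors \<kappa> C = Some (IdleWith \<Phi>)" "InfoMsg y z B \<in># msgs \<kappa> C"
| send_release:
    "step U \<kappa> (SendRelease A x n)
       (post (target x) (ReleaseMsg x n)
         (set_actor A (BusyWith (\<Phi> - {Activated x, SentCount x n})) \<kappa>))"
  if "actors \<kappa> A = Some (BusyWith \<Phi>)" "Activated x \<in> \<Phi>" "owner x = A"
     "\<Phi> \<turnstile> SentCount x n" "\<forall>z. CreatedUsing x z \<notin> \<Phi>"
| release:
    "step U \<kappa> (Release B x n)
       (consume B (ReleaseMsg x n) (set_actor B (IdleWith (\<Phi> \<union> {Released x})) \<kappa>))"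
  if "actors \<kappa> B = Some (IdleWith \<Phi>)" "ReleaseMsg x n \<in># msgs \<kappa> B" "\<Phi> \<turnstile> RecvCount x n"
| compaction:
    "step U \<kappa> (Compaction C x)
       (set_actor C (IdleWith (\<Phi> - {Created x, Released x} - {RecvCount x n | n. True})) \<kappa>)"
  if "actors \<kappa> C = Some (IdleWith \<Phi>)" "Created x \<in> \<Phi>" "Released x \<in> \<Phi>" "target x = C"
| snapshot:
    "step U \<kappa> (Snapshot A \<Phi>) \<kappa>"
  if "actors \<kappa> A = Some (IdleWith \<Phi>)"
| "in":
    "step U \<kappa> (In A R)
       (post A (App None R)
         (\<kappa>\<lparr>externals := externals \<kappa> \<union> (target ` R - dom (actors \<kappa>))\<rparr>))"
  if "A \<in> receptionists \<kappa>" "finite R"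
     "\<forall>x \<in> R. owner x = A \<and> token x \<notin> U" "inj_on token R"
     "target ` R \<inter> dom (actors \<kappa>) \<subseteq> receptionists \<kappa>"
| out:
    "step U \<kappa> (Out B w R)
       (consume B (App w R)
         (\<kappa>\<lparr>receptionists := receptionists \<kappa> \<union> (target ` R \<inter> dom (actors \<kappa>))\<rparr>))"
  if "B \<in> externals \<kappa>" "App w R \<in># msgs \<kappa> B"
| release_out:
    "step U \<kappa> (ReleaseOut B x n) (consume B (ReleaseMsg x n) \<kappa>)"
  if "B \<in> externals \<kappa>" "ReleaseMsg x n \<in># msgs \<kappa> B"
| info_out:
    "step U \<kappa> (InfoOut C y z B) (consume C (InfoMsg y z B) \<kappa>)"
  if "C \<in> externals \<kappa>" "InfoMsg y z B \<in># msgs \<kappa> C"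

text \<open>Only the first \<open>N\<close> events matter; \<open>N = \<infinity>\<close> gives infinite sequences.\<close>

definition steps ::
  "(nat \<Rightarrow> ('t, 'a) config) \<Rightarrow> (nat \<Rightarrow> ('t, 'a) event) \<Rightarrow> enat \<Rightarrow> bool" where
  "steps \<kappa> e N \<longleftrightarrow> (\<forall>t. enat t < N \<longrightarrow> step (\<Union>s \<in> {..t}. tokens (\<kappa> s)) (\<kappa> t) (e t) (\<kappa> (Suc t)))"

definition initial :: "('t, 'a) config \<Rightarrow> bool" where
  "initial \<kappa> \<longleftrightarrow> (\<exists>A E x y. A \<noteq> E \<and> token x \<noteq> token y
     \<and> owner x = A \<and> target x = E \<and> owner y = A \<and> target y = A
     \<and> \<kappa> = \<lparr>actors = [A \<mapsto> BusyWith {Activated x, Created y, Activated y}],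
            msgs = (\<lambda>_. {#}), receptionists = {}, externals = {E}\<rparr>)"

definition execution ::
  "(nat \<Rightarrow> ('t, 'a) config) \<Rightarrow> (nat \<Rightarrow> ('t, 'a) event) \<Rightarrow> enat \<Rightarrow> bool" where
  "execution \<kappa> e N \<longleftrightarrow> initial (\<kappa> 0) \<and> steps \<kappa> e N"

text \<open>The history used for freshness starts afresh at \<open>\<kappa>\<close> here. Every continuation of an execution
  through \<open>\<kappa>\<close> is such a sequence.\<close>

definition potentially_receives :: "'a \<Rightarrow> ('t, 'a) config \<Rightarrow> bool" where
  "potentially_receives A \<kappa> \<longleftrightarrow>
     (\<exists>\<kappa>' e n. \<kappa>' 0 = \<kappa> \<and> steps \<kappa>' e (enat n) \<and> msgs (\<kappa>' n) A \<noteq> {#})"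

definition terminated :: "'a \<Rightarrow> ('t, 'a) config \<Rightarrow> bool" where
  "terminated A \<kappa> \<longleftrightarrow> (\<exists>\<Phi>. actors \<kappa> A = Some (IdleWith \<Phi>)) \<and> \<not> potentially_receives A \<kappa>"

text \<open>A set of snapshots with at most one snapshot per actor is a partial map.\<close>

type_synonym ('t, 'a) snapshots = "'a \<rightharpoonup> ('t, 'a) knowledge"

definition snapshots_entail :: "('t, 'a) snapshots \<Rightarrow> ('t, 'a) fact \<Rightarrow> bool" (infix "\<turnstile>\<^sub>Q" 50) where
  "Q \<turnstile>\<^sub>Q \<phi> \<longleftrightarrow> (\<exists>\<Phi> \<in> ran Q. \<Phi> \<turnstile> \<phi>)"

definition closed_snapshots :: "('t, 'a) snapshots \<Rightarrow> bool" where
  "closed_snapshots Q \<longleftrightarrow>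
     (\<forall>x. Q \<turnstile>\<^sub>Q Unreleased x \<and> target x \<in> dom Q \<longrightarrow>
        (\<exists>\<Phi>. Q (owner x) = Some \<Phi> \<and> \<Phi> \<turnstile> Activated x))"

definition appears_blocked :: "('t, 'a) snapshots \<Rightarrow> 'a \<Rightarrow> bool" where
  "appears_blocked Q B \<longleftrightarrow>
     (\<forall>x. target x = B \<and> Q \<turnstile>\<^sub>Q Unreleased x \<longrightarrow>
        (\<exists>\<Phi>\<^sub>A \<Phi>\<^sub>B n. Q (owner x) = Some \<Phi>\<^sub>A \<and> Q B = Some \<Phi>\<^sub>B
           \<and> \<Phi>\<^sub>A \<turnstile> SentCount x n \<and> \<Phi>\<^sub>B \<turnstile> RecvCount x n))"

definition finalized :: "('t, 'a) snapshots \<Rightarrow> bool" where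
  "finalized Q \<longleftrightarrow> closed_snapshots Q \<and> (\<forall>B \<in> dom Q. appears_blocked Q B)"

definition snapshots_taken_by ::
  "(nat \<Rightarrow> ('t, 'a) event) \<Rightarrow> enat \<Rightarrow> nat \<Rightarrow> ('t, 'a) snapshots \<Rightarrow> bool" where
  "snapshots_taken_by e N t\<^sub>f Q \<longleftrightarrow>
     (\<forall>A \<Phi>. Q A = Some \<Phi> \<longrightarrow> (\<exists>t \<le> t\<^sub>f. enat t < N \<and> e t = Snapshot A \<Phi>))"

end

theory Submission
  imports Defs
begin

text \<open>An unreleased refob towards an internal actor that is not a receptionist is the end of a chain of
  unreleased refobs towards that actor: the target has recorded the creation of some refob towards
  itself, and each refob of the chain was used to create the next one, a fact still recorded by
  its owner or travelling in an info message. Let the target \<open>B\<close> have a snapshot in \<open>Q\<close> and have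
  received nothing since. By induction along the chain, \<open>Q\<close> entails that each of its refobs is
  unreleased: closedness gives a snapshot of the owner in which the refob is activated, and
  the agreement of its send and receive counts, together with the monotonicity of the send count,
  shows that no message along it is in transit and that its owner's snapshot still records
  the creation of the next refob. Hence nothing can reach \<open>B\<close>, and by induction on time the snapshot
  actors stay idle until \<open>t\<^sub>f\<close>. At that time every refob towards a snapshot actor is owned by
  a snapshot actor, a situation that no event can change.

  Receptionists are excluded because each of them is the target of a chained refob with an external
  owner, which has no snapshot.\<close>

lemma entails_simps:
  "\<Phi> \<turnstile> Activated x \<longleftrightarrow> Activated x \<in> \<Phi>"
  "\<Phi> \<turnstile> CreatedUsing x y \<longleftrightarrow> CreatedUsing x y \<in> \<Phi>"
  "\<Phi> \<turnstile> SentCount x n \<longleftrightarrow> SentCount x n \<in> \<Phi> \<or> n = 0 \<and> (\<forall>m. SentCount x m \<notin> \<Phi>)"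
  "\<Phi> \<turnstile> RecvCount x n \<longleftrightarrow> RecvCount x n \<in> \<Phi> \<or> n = 0 \<and> (\<forall>m. RecvCount x m \<notin> \<Phi>)"
  by (auto elim: entails.cases intro: entails.intros)

section \<open>Reading a configuration\<close>

text \<open>External and unborn actors get the empty set, so the invariants can range over all names
  without asking who exists.\<close>

definition facts :: "('t, 'a) config \<Rightarrow> 'a \<Rightarrow> ('t, 'a) knowledge" where
  "facts \<kappa> A = (case actors \<kappa> A of None \<Rightarrow> {} | Some s \<Rightarrow> state_facts s)"

text \<open>For the unique counts that occur in executions, the supremum is the recorded count, and \<open>0\<close>
  if there is none.\<close>

definition scount :: "('t, 'a) knowledge \<Rightarrow> ('t, 'a) refob \<Rightarrow> nat" where
  "scount \<Phi> x = Sup {n. SentCount x n \<in> \<Phi>}"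

definition rcount :: "('t, 'a) knowledge \<Rightarrow> ('t, 'a) refob \<Rightarrow> nat" where
  "rcount \<Phi> x = Sup {n. RecvCount x n \<in> \<Phi>}"

text \<open>Every recorded count is equated with one number, so there is at most one per
  refob.\<close>

definition counts_unique :: "('t, 'a) knowledge \<Rightarrow> bool" where
  "counts_unique \<Phi> \<longleftrightarrow> (\<forall>x n. SentCount x n \<in> \<Phi> \<longrightarrow> n = scount \<Phi> x)
     \<and> (\<forall>x n. RecvCount x n \<in> \<Phi> \<longrightarrow> n = rcount \<Phi> x)"

fun carries :: "('t, 'a) refob \<Rightarrow> ('t, 'a) message \<Rightarrow> bool" where
  "carries x (App w R) \<longleftrightarrow> x \<in> R"
| "carries x _ \<longleftrightarrow> False"

text \<open>These are the messages that the send and receive counts of \<open>x\<close> count;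
  release messages change neither count.\<close>

fun along :: "('t, 'a) refob \<Rightarrow> ('t, 'a) message \<Rightarrow> bool" where
  "along x (App w R) \<longleftrightarrow> w = Some x"
| "along x (InfoMsg y z B) \<longleftrightarrow> y = x"
| "along x (ReleaseMsg y n) \<longleftrightarrow> False"

fun releases :: "('t, 'a) refob \<Rightarrow> ('t, 'a) message \<Rightarrow> bool" where
  "releases x (ReleaseMsg y n) \<longleftrightarrow> y = x"
| "releases x _ \<longleftrightarrow> False"

definition pending :: "(('t, 'a) message \<Rightarrow> bool) \<Rightarrow> 'a \<Rightarrow> ('t, 'a) config \<Rightarrow> nat" where
  "pending P A \<kappa> = size (filter_mset P (msgs \<kappa> A))"

abbreviation transit :: "('t, 'a) config \<Rightarrow> ('t, 'a) refob \<Rightarrow> nat" where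
  "transit \<kappa> x \<equiv> pending (carries x) (owner x) \<kappa>"

abbreviation inflight :: "('t, 'a) config \<Rightarrow> ('t, 'a) refob \<Rightarrow> nat" where
  "inflight \<kappa> x \<equiv> pending (along x) (target x) \<kappa>"

abbreviation releasing :: "('t, 'a) config \<Rightarrow> ('t, 'a) refob \<Rightarrow> nat" where
  "releasing \<kappa> x \<equiv> pending (releases x) (target x) \<kappa>"

abbreviation active :: "('t, 'a) config \<Rightarrow> ('t, 'a) refob \<Rightarrow> bool" where
  "active \<kappa> x \<equiv> Activated x \<in> facts \<kappa> (owner x)"

text \<open>A refob passes from being in transit to its owner, through being active, to having its release
  message in transit. It is in at most one of these phases, and never returns to an earlier one.\<close>

definition phase :: "('t, 'a) config \<Rightarrow> ('t, 'a) refob \<Rightarrow> nat" where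
  "phase \<kappa> x = transit \<kappa> x + of_bool (active \<kappa> x) + releasing \<kappa> x"

lemma facts_set_actor [simp]: "facts (set_actor A s \<kappa>) = (facts \<kappa>)(A := state_facts s)"
  and facts_post [simp]: "facts (post B m \<kappa>) = facts \<kappa>"
  and facts_consume [simp]: "facts (consume B m \<kappa>) = facts \<kappa>"
  and facts_externals [simp]: "facts (\<kappa>\<lparr>externals := X\<rparr>) = facts \<kappa>"
  and facts_receptionists [simp]: "facts (\<kappa>\<lparr>receptionists := X\<rparr>) = facts \<kappa>"
  by (auto simp: facts_def set_actor_def post_def consume_def fun_eq_iff)

lemma config_simps [simp]:
  "actors (set_actor A s \<kappa>) = (actors \<kappa>)(A \<mapsto> s)"
  "msgs (set_actor A s \<kappa>) = msgs \<kappa>"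
  "externals (set_actor A s \<kappa>) = externals \<kappa>"
  "receptionists (set_actor A s \<kappa>) = receptionists \<kappa>"
  "actors (post B m \<kappa>) = actors \<kappa>"
  "msgs (post B m \<kappa>) = (msgs \<kappa>)(B := add_mset m (msgs \<kappa> B))"
  "externals (post B m \<kappa>) = externals \<kappa>"
  "receptionists (post B m \<kappa>) = receptionists \<kappa>"
  "actors (consume B m \<kappa>) = actors \<kappa>"
  "msgs (consume B m \<kappa>) = (msgs \<kappa>)(B := msgs \<kappa> B - {#m#})"
  "externals (consume B m \<kappa>) = externals \<kappa>"
  "receptionists (consume B m \<kappa>) = receptionists \<kappa>"
  by (auto simp: set_actor_def post_def consume_def)

lemma facts_Some: "actors \<kappa> A = Some (BusyWith \<Phi>) \<Longrightarrow> facts \<kappa> A = \<Phi>"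
  "actors \<kappa> A = Some (IdleWith \<Phi>) \<Longrightarrow> facts \<kappa> A = \<Phi>"
  "A \<notin> dom (actors \<kappa>) \<Longrightarrow> facts \<kappa> A = {}"
  by (auto simp: facts_def split: option.splits)

lemma pending_simps [simp]:
  "pending P A (set_actor B s \<kappa>) = pending P A \<kappa>"
  "pending P A (post B m \<kappa>) = pending P A \<kappa> + of_bool (A = B \<and> P m)"
  "pending P A (\<kappa>\<lparr>externals := X\<rparr>) = pending P A \<kappa>"
  "pending P A (\<kappa>\<lparr>receptionists := X\<rparr>) = pending P A \<kappa>"
  by (auto simp: pending_def)

text \<open>The additive form avoids truncated subtraction.\<close>

lemma pending_consume:
  assumes "m \<in># msgs \<kappa> B"
  shows "pending P A \<kappa> = pending P A (consume B m \<kappa>) + of_bool (A = B \<and> P m)"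
proof -
  obtain M where "msgs \<kappa> B = add_mset m M"
    using assms by (metis insert_DiffM)
  then show ?thesis by (auto simp: pending_def)
qed

lemma pending_pos: "m \<in># msgs \<kappa> A \<Longrightarrow> P m \<Longrightarrow> pending P A \<kappa> > 0"
  by (auto simp: pending_def simp flip: nonempty_has_size)

lemma pending_eq_0_iff: "pending P A \<kappa> = 0 \<longleftrightarrow> (\<forall>m \<in># msgs \<kappa> A. \<not> P m)"
  by (auto simp: pending_def)

section \<open>Counts as functions of a knowledge set\<close>

lemma count_cong:
  "{n. SentCount x n \<in> \<Phi>} = {n. SentCount x n \<in> \<Psi>} \<Longrightarrow> scount \<Phi> x = scount \<Psi> x"
  "{n. RecvCount x n \<in> \<Phi>} = {n. RecvCount x n \<in> \<Psi>} \<Longrightarrow> rcount \<Phi> x = rcount \<Psi> x"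
  by (simp_all add: scount_def rcount_def)

lemma count_eq_0:
  "(\<And>n. SentCount x n \<notin> \<Phi>) \<Longrightarrow> scount \<Phi> x = 0"
  "(\<And>n. RecvCount x n \<notin> \<Phi>) \<Longrightarrow> rcount \<Phi> x = 0"
  by (simp_all add: scount_def rcount_def)

text \<open>The default count 0 of \<open>entails\<close> agrees with the supremum of the empty set,
  so entailment of a count becomes an equation.\<close>

lemma entails_count:
  assumes "counts_unique \<Phi>"
  shows "\<Phi> \<turnstile> SentCount x n \<longleftrightarrow> n = scount \<Phi> x" "\<Phi> \<turnstile> RecvCount x n \<longleftrightarrow> n = rcount \<Phi> x"
  using assms by (auto simp: entails_simps counts_unique_def count_eq_0) (metis count_eq_0)+

lemma in_inc_sent:
  assumes "counts_unique \<Phi>"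
  shows "\<phi> \<in> inc_sent x \<Phi> \<longleftrightarrow> \<phi> \<in> \<Phi> \<and> (\<forall>n. \<phi> \<noteq> SentCount x n) \<or> \<phi> = SentCount x (Suc (scount \<Phi> x))"
  using assms by (auto simp: inc_sent_def entails_count)

lemma in_inc_recv:
  assumes "counts_unique \<Phi>"
  shows "\<phi> \<in> inc_recv x \<Phi> \<longleftrightarrow> \<phi> \<in> \<Phi> \<and> (\<forall>n. \<phi> \<noteq> RecvCount x n) \<or> \<phi> = RecvCount x (Suc (rcount \<Phi> x))"
  using assms by (auto simp: inc_recv_def entails_count)

lemma count_inc [simp]:
  assumes "counts_unique \<Phi>"
  shows "scount (inc_sent x \<Phi>) y = (if y = x then Suc (scount \<Phi> x) else scount \<Phi> y)"
    and "rcount (inc_sent x \<Phi>) y = rcount \<Phi> y"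
    and "rcount (inc_recv x \<Phi>) y = (if y = x then Suc (rcount \<Phi> x) else rcount \<Phi> y)"
    and "scount (inc_recv x \<Phi>) y = scount \<Phi> y"
  using assms by (auto simp: scount_def rcount_def in_inc_sent in_inc_recv intro!: arg_cong[where f = Sup])

lemma count_simps [simp]:
  "scount (\<Phi> \<union> {CreatedUsing y z | y z. P y z}) x = scount \<Phi> x"
  "rcount (\<Phi> \<union> {CreatedUsing y z | y z. P y z}) x = rcount \<Phi> x"
  "scount (\<Phi> \<union> Activated ` R) x = scount \<Phi> x"
  "rcount (\<Phi> \<union> Activated ` R) x = rcount \<Phi> x"
  "scount (\<Phi> - {CreatedUsing y z}) x = scount \<Phi> x"
  "rcount (\<Phi> - {CreatedUsing y z}) x = rcount \<Phi> x"
  "scount (insert (Activated y) \<Phi>) x = scount \<Phi> x"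
  "rcount (insert (Activated y) \<Phi>) x = rcount \<Phi> x"
  "scount (insert (Created y) \<Phi>) x = scount \<Phi> x"
  "rcount (insert (Created y) \<Phi>) x = rcount \<Phi> x"
  "scount (insert (Released y) \<Phi>) x = scount \<Phi> x"
  "rcount (insert (Released y) \<Phi>) x = rcount \<Phi> x"
  "rcount (\<Phi> - {Activated y, SentCount y n}) x = rcount \<Phi> x"
  "x \<noteq> y \<Longrightarrow> scount (\<Phi> - {Activated y, SentCount y n}) x = scount \<Phi> x"
  "scount {} x = 0" "rcount {} x = 0"
  by (auto intro!: count_cong count_eq_0)

lemma counts_unique_inc [simp]:
  "counts_unique \<Phi> \<Longrightarrow> counts_unique (inc_sent x \<Phi>)"
  "counts_unique \<Phi> \<Longrightarrow> counts_unique (inc_recv x \<Phi>)"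
  by (auto simp: counts_unique_def[of "inc_sent x \<Phi>"] counts_unique_def[of "inc_recv x \<Phi>"]
      in_inc_sent in_inc_recv) (auto simp: counts_unique_def)

lemma counts_unique_simps [simp]:
  "counts_unique {}"
  "counts_unique (\<Phi> \<union> {CreatedUsing y z | y z. P y z}) = counts_unique \<Phi>"
  "counts_unique (\<Phi> \<union> Activated ` R) = counts_unique \<Phi>"
  "counts_unique (\<Phi> - {CreatedUsing y z}) = counts_unique \<Phi>"
  "counts_unique (insert (Activated y) \<Phi>) = counts_unique \<Phi>"
  "counts_unique (insert (Created y) \<Phi>) = counts_unique \<Phi>"
  "counts_unique (insert (Released y) \<Phi>) = counts_unique \<Phi>"
  by (auto simp: counts_unique_def)

text \<open>Since \<open>scount\<close> is computed in each set separately, inclusion alone does not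
  settle this: a nonempty set of counts in \<Psi> is the same singleton as in \<Phi>.\<close>

lemma counts_unique_mono:
  assumes "counts_unique \<Phi>" "\<Psi> \<subseteq> \<Phi>" shows "counts_unique \<Psi>"
proof -
  have "{n. SentCount x n \<in> \<Psi>} = {n}" if "SentCount x n \<in> \<Psi>" for x n
    using that assms unfolding counts_unique_def by blast
  moreover have "{n. RecvCount x n \<in> \<Psi>} = {n}" if "RecvCount x n \<in> \<Psi>" for x n
    using that assms unfolding counts_unique_def by blast
  ultimately show ?thesis by (simp add: counts_unique_def scount_def rcount_def)
qed

lemma fresh:
  assumes "token x \<notin> tokens \<kappa>"
  shows "\<phi> \<in> facts \<kappa> A \<Longrightarrow> x \<notin> fact_refobs \<phi>" "m \<in># msgs \<kappa> A \<Longrightarrow> x \<notin> message_refobs m"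
  using assms by (auto simp: tokens_def facts_def ran_def split: option.splits)


lemma inc_mem [simp]:
  "SentCount z n \<in> inc_sent x \<Phi> \<longleftrightarrow> (if z = x then \<exists>m. n = Suc m \<and> \<Phi> \<turnstile> SentCount x m else SentCount z n \<in> \<Phi>)"
  "RecvCount z n \<in> inc_sent x \<Phi> \<longleftrightarrow> RecvCount z n \<in> \<Phi>"
  "Created z \<in> inc_sent x \<Phi> \<longleftrightarrow> Created z \<in> \<Phi>"
  "Released z \<in> inc_sent x \<Phi> \<longleftrightarrow> Released z \<in> \<Phi>"
  "Activated z \<in> inc_sent x \<Phi> \<longleftrightarrow> Activated z \<in> \<Phi>"
  "Unreleased z \<in> inc_sent x \<Phi> \<longleftrightarrow> Unreleased z \<in> \<Phi>"
  "CreatedUsing y z \<in> inc_sent x \<Phi> \<longleftrightarrow> CreatedUsing y z \<in> \<Phi>"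
  "RecvCount z n \<in> inc_recv x \<Phi> \<longleftrightarrow> (if z = x then \<exists>m. n = Suc m \<and> \<Phi> \<turnstile> RecvCount x m else RecvCount z n \<in> \<Phi>)"
  "SentCount z n \<in> inc_recv x \<Phi> \<longleftrightarrow> SentCount z n \<in> \<Phi>"
  "Created z \<in> inc_recv x \<Phi> \<longleftrightarrow> Created z \<in> \<Phi>"
  "Released z \<in> inc_recv x \<Phi> \<longleftrightarrow> Released z \<in> \<Phi>"
  "Activated z \<in> inc_recv x \<Phi> \<longleftrightarrow> Activated z \<in> \<Phi>"
  "Unreleased z \<in> inc_recv x \<Phi> \<longleftrightarrow> Unreleased z \<in> \<Phi>"
  "CreatedUsing y z \<in> inc_recv x \<Phi> \<longleftrightarrow> CreatedUsing y z \<in> \<Phi>"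
  by (auto simp: inc_sent_def inc_recv_def)

lemma pending_consume_simps [simp]:
  "pending P A (consume B m (set_actor C s \<kappa>)) = pending P A (consume B m \<kappa>)"
  "pending P A (consume B m (\<kappa>\<lparr>receptionists := X\<rparr>)) = pending P A (consume B m \<kappa>)"
  by (simp_all add: pending_def)

lemma count_compaction [simp]:
  "scount (\<Phi> - {Created y, Released y} - {u. \<exists>n. u = RecvCount y n}) x = scount \<Phi> x"
  "x \<noteq> y \<Longrightarrow> rcount (\<Phi> - {Created y, Released y} - {u. \<exists>n. u = RecvCount y n}) x = rcount \<Phi> x"
  by (auto intro!: count_cong)

section \<open>Locations of facts and messages\<close>

text \<open>Only internal actors deactivate refobs, so the owner of a released refob is internal;
  this later separates released refobs from live ones. \<open>Unreleased\<close> is derived, never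
  stored.\<close>

fun fact_ok :: "('t, 'a) config \<Rightarrow> 'a \<Rightarrow> ('t, 'a) fact \<Rightarrow> bool" where
  "fact_ok \<kappa> A (Created x) \<longleftrightarrow> target x = A"
| "fact_ok \<kappa> A (Released x) \<longleftrightarrow> target x = A \<and> owner x \<in> dom (actors \<kappa>)"
| "fact_ok \<kappa> A (CreatedUsing y z) \<longleftrightarrow> owner y = A \<and> target z = target y"
| "fact_ok \<kappa> A (Activated x) \<longleftrightarrow> owner x = A"
| "fact_ok \<kappa> A (Unreleased x) \<longleftrightarrow> False"
| "fact_ok \<kappa> A (SentCount x n) \<longleftrightarrow> owner x = A"
| "fact_ok \<kappa> A (RecvCount x n) \<longleftrightarrow> target x = A"

text \<open>By the case \<open>None\<close>, an actor that is not a receptionist gets application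
  messages only along refobs that target it.\<close>

fun message_ok :: "('t, 'a) config \<Rightarrow> 'a \<Rightarrow> ('t, 'a) message \<Rightarrow> bool" where
  "message_ok \<kappa> A (App w R) \<longleftrightarrow> (\<forall>x \<in> R. owner x = A)
     \<and> (case w of None \<Rightarrow> A \<in> receptionists \<kappa> | Some x \<Rightarrow> target x = A)"
| "message_ok \<kappa> A (InfoMsg y z B) \<longleftrightarrow> target y = A \<and> target z = A"
| "message_ok \<kappa> A (ReleaseMsg x n) \<longleftrightarrow> target x = A \<and> owner x \<in> dom (actors \<kappa>)"

text \<open>The last clause makes the send count of an inactive refob 0 and lets a
  \<open>CreatedUsing\<close> fact witness that its first refob is active.\<close>

definition located :: "('t, 'a) config \<Rightarrow> bool" where
  "located \<kappa> \<longleftrightarrow> dom (actors \<kappa>) \<inter> externals \<kappa> = {} \<and> receptionists \<kappa> \<subseteq> dom (actors \<kappa>)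
     \<and> (\<forall>A. \<forall>\<phi> \<in> facts \<kappa> A. fact_ok \<kappa> A \<phi>)
     \<and> (\<forall>A. \<forall>m \<in># msgs \<kappa> A. message_ok \<kappa> A m)
     \<and> (\<forall>A. counts_unique (facts \<kappa> A))
     \<and> (\<forall>x. \<not> active \<kappa> x \<longrightarrow> (\<forall>n. SentCount x n \<notin> facts \<kappa> (owner x))
                        \<and> (\<forall>z. CreatedUsing x z \<notin> facts \<kappa> (owner x)))"

lemma locatedD:
  assumes "located \<kappa>"
  shows "dom (actors \<kappa>) \<inter> externals \<kappa> = {}" "receptionists \<kappa> \<subseteq> dom (actors \<kappa>)"
    "\<phi> \<in> facts \<kappa> A \<Longrightarrow> fact_ok \<kappa> A \<phi>" "m \<in># msgs \<kappa> A \<Longrightarrow> message_ok \<kappa> A m"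
    "counts_unique (facts \<kappa> A)"
    "SentCount x n \<in> facts \<kappa> (owner x) \<Longrightarrow> active \<kappa> x"
    "CreatedUsing x z \<in> facts \<kappa> (owner x) \<Longrightarrow> active \<kappa> x"
  using assms unfolding located_def by (simp_all, metis+)

lemma fact_ok_mono: "fact_ok \<kappa> A \<phi> \<Longrightarrow> dom (actors \<kappa>) \<subseteq> dom (actors \<kappa>') \<Longrightarrow> fact_ok \<kappa>' A \<phi>"
  by (cases \<phi>) auto

lemma message_ok_mono:
  "message_ok \<kappa> A m \<Longrightarrow> dom (actors \<kappa>) \<subseteq> dom (actors \<kappa>') \<Longrightarrow> receptionists \<kappa> \<subseteq> receptionists \<kappa>'
    \<Longrightarrow> message_ok \<kappa>' A m"
  by (cases m) (auto split: option.splits)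

lemma step_mono:
  assumes "step U \<kappa> ev \<kappa>'"
  shows "dom (actors \<kappa>) \<subseteq> dom (actors \<kappa>')" "externals \<kappa> \<subseteq> externals \<kappa>'"
    "receptionists \<kappa> \<subseteq> receptionists \<kappa>'"
  using assms by (cases rule: step.cases; auto)+

lemma step_externals_disjoint:
  assumes "step U \<kappa> ev \<kappa>'" "dom (actors \<kappa>) \<inter> externals \<kappa> = {}"
  shows "dom (actors \<kappa>') \<inter> externals \<kappa>' = {}"
  using assms by (cases rule: step.cases) auto

lemma step_receptionists_internal:
  assumes "step U \<kappa> ev \<kappa>'" "receptionists \<kappa> \<subseteq> dom (actors \<kappa>)"
  shows "receptionists \<kappa>' \<subseteq> dom (actors \<kappa>')"
  using assms by (cases rule: step.cases) auto

lemma step_counts_unique: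
  assumes "step U \<kappa> ev \<kappa>'" "\<And>A. counts_unique (facts \<kappa> A)"
  shows "counts_unique (facts \<kappa>' A)"
proof -
  have known: "counts_unique \<Phi>"
    if "actors \<kappa> B = Some (BusyWith \<Phi>) \<or> actors \<kappa> B = Some (IdleWith \<Phi>)" for B \<Phi>
    using assms(2)[of B] that by (auto simp: facts_Some)
  note [simp] = assms(2)
  show ?thesis
    using assms(1)
  proof (cases rule: step.cases)
    case (spawn B \<Phi> C x y)
    then show ?thesis using known[of B \<Phi>] by simp
  next
    case (send B \<Phi> x yzs)
    then show ?thesis using known[of B \<Phi>] by simp
  next
    case (receive B \<Phi> w R)
    then show ?thesis using known[of B \<Phi>] by (simp split: option.split)
  next
    case (idle B \<Phi>)
    then show ?thesis using known[of B \<Phi>] by simp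
  next
    case (send_info B \<Phi> y z)
    then show ?thesis using known[of B \<Phi>] by simp
  next
    case (info B \<Phi> y z C)
    then show ?thesis using known[of B \<Phi>] by simp
  next
    case (send_release B \<Phi> x n)
    then show ?thesis using known[of B \<Phi>] counts_unique_mono[of \<Phi>] by simp
  next
    case (release B \<Phi> x n)
    then show ?thesis using known[of B \<Phi>] by simp
  next
    case (compaction B \<Phi> x)
    then show ?thesis
      using known[of B \<Phi>] counts_unique_mono[of \<Phi> "\<Phi> - {Created x, Released x} - {RecvCount x n | n. True}"]
      by auto
  qed simp_all
qed

text \<open>Only added facts need a check: \<open>fact_ok\<close> depends on the configuration
  through the set of internal actors alone, and that set grows.\<close>

lemma step_fact_ok:
  assumes "step U \<kappa> ev \<kappa>'" "located \<kappa>" "\<phi> \<in> facts \<kappa>' A"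
  shows "fact_ok \<kappa>' A \<phi>"
proof -
  note old_msg = locatedD(4)[OF assms(2)] and unique = locatedD(5)[OF assms(2)]
  have "\<phi> \<in> facts \<kappa> A \<or> fact_ok \<kappa>' A \<phi>"
    using assms(1)
  proof (cases rule: step.cases)
    case (spawn B \<Phi> C x y)
    then show ?thesis using assms(3) by (auto simp: facts_Some split: if_splits)
  next
    case (send B \<Phi> x yzs)
    then show ?thesis
      using assms(3) unique[of B] by (auto simp: facts_Some in_inc_sent entails_simps split: if_splits)
  next
    case (receive B \<Phi> w R)
    then show ?thesis
      using assms(3) old_msg[of "App w R" B] unique[of B]
      by (auto simp: facts_Some in_inc_recv split: if_splits option.splits)
  next
    case (send_info B \<Phi> y z)
    then show ?thesis
      using assms(3) unique[of B] by (auto simp: facts_Some in_inc_sent split: if_splits)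
  next
    case (info C \<Phi> y z B)
    then show ?thesis
      using assms(3) old_msg[of "InfoMsg y z B" C] unique[of C]
      by (auto simp: facts_Some in_inc_recv split: if_splits)
  next
    case (release B \<Phi> x n)
    then show ?thesis
      using assms(3) old_msg[of "ReleaseMsg x n" B]
      by (auto simp: facts_Some split: if_splits)
  qed (use assms(3) in \<open>auto simp: facts_Some split: if_splits\<close>)
  then show ?thesis
    using fact_ok_mono[OF locatedD(3)[OF assms(2)] step_mono(1)[OF assms(1)]] by metis
qed

lemma step_message_ok:
  assumes "step U \<kappa> ev \<kappa>'" "located \<kappa>" "m \<in># msgs \<kappa>' A"
  shows "message_ok \<kappa>' A m"
proof -
  have "m \<in># msgs \<kappa> A \<or> message_ok \<kappa>' A m"
    using assms(1)
  proof (cases rule: step.cases)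
    case (send B \<Phi> x yzs)
    then show ?thesis using assms(3) by (fastforce split: if_splits)
  qed (use assms(3) in \<open>auto split: if_splits dest: in_diffD\<close>)
  then show ?thesis
    using message_ok_mono[OF locatedD(4)[OF assms(2)] step_mono(1,3)[OF assms(1)]] by metis
qed

lemma step_active_facts:
  assumes "step U \<kappa> ev \<kappa>'" "located \<kappa>"
    and "SentCount x n \<in> facts \<kappa>' (owner x) \<or> CreatedUsing x z \<in> facts \<kappa>' (owner x)"
  shows "active \<kappa>' x"
proof -
  note unique = locatedD(5)[OF assms(2)]
  note active = locatedD(6,7)[OF assms(2), of x]
  show ?thesis
    using assms(1)
  proof (cases rule: step.cases)
    case (spawn A \<Phi> B y z)
    then show ?thesis using assms(3) active by (auto simp: facts_Some split: if_splits)
  next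
    case (send A \<Phi> y yzs)
    then show ?thesis
      using assms(3) active 
      by (auto simp: facts_Some entails_simps split: if_splits)
  next
    case (receive B \<Phi> w R)
    then show ?thesis
      using assms(3) active unique[of B]
      by (auto simp: facts_Some split: if_splits option.splits)
  next
    case (send_info A \<Phi> y u)
    then show ?thesis
      using assms(3) active 
      by (auto simp: facts_Some split: if_splits)
  next
    case (info C \<Phi> y u B)
    then show ?thesis
      using assms(3) active unique[of C]
      by (auto simp: facts_Some split: if_splits)
  next
    case (send_release A \<Phi> y m)
    \<comment> \<open>The removed count is the only one recorded, so deactivation leaves no send
      count behind.\<close>
    have "m = k" if "SentCount y k \<in> \<Phi>" for k
      using that send_release unique[of A] by (metis entails_count(1) entails.member facts_Some(1))
    then show ?thesis
      using assms(3) active send_release by (auto simp: facts_Some split: if_splits)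
  qed (use assms(3) active in \<open>auto simp: facts_Some split: if_splits\<close>)
qed

lemma step_located:
  assumes "step U \<kappa> ev \<kappa>'" "located \<kappa>"
  shows "located \<kappa>'"
  unfolding located_def
  using step_externals_disjoint[OF assms(1)] step_receptionists_internal[OF assms(1)]
    step_counts_unique[OF assms(1)] step_fact_ok[OF assms] step_message_ok[OF assms]
    step_active_facts[OF assms] locatedD[OF assms(2)]
  by metis

section \<open>The life cycle of a refob\<close>

fun sent_along :: "('t, 'a) refob \<Rightarrow> ('t, 'a) event \<Rightarrow> bool" where
  "sent_along x (Send A y yzs) \<longleftrightarrow> y = x"
| "sent_along x (SendInfo A y z) \<longleftrightarrow> y = x"
| "sent_along x _ \<longleftrightarrow> False"

fun received_along :: "('t, 'a) refob \<Rightarrow> ('t, 'a) event \<Rightarrow> bool" where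
  "received_along x (Receive B w R) \<longleftrightarrow> w = Some x"
| "received_along x (Info C y z B) \<longleftrightarrow> y = x"
| "received_along x _ \<longleftrightarrow> False"

fun introduces :: "('t, 'a) event \<Rightarrow> ('t, 'a) refob set" where
  "introduces (Spawn A B x y) = {x, y}"
| "introduces (Send A x yzs) = snd ` set yzs"
| "introduces (In A R) = R"
| "introduces _ = {}"

lemma introduces_fresh: "step U \<kappa> ev \<kappa>' \<Longrightarrow> x \<in> introduces ev \<Longrightarrow> token x \<notin> U"
  by (cases rule: step.cases) force+

context
  fixes U :: "'t set" and \<kappa> \<kappa>' :: "('t, 'a) config" and ev :: "('t, 'a) event"
  assumes step: "step U \<kappa> ev \<kappa>'" and located: "located \<kappa>"
begin

lemma counts_unique_state:
  assumes "actors \<kappa> A = Some (BusyWith \<Phi>) \<or> actors \<kappa> A = Some (IdleWith \<Phi>)"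
  shows "counts_unique \<Phi>"
  using assms locatedD(5)[OF located, of A] by (auto simp: facts_Some)

text \<open>\<open>Receive\<close> moves a refob from transit to active and
  \<open>SendRelease\<close> from active to releasing; every other event keeps its phase, ends it,
  or introduces the refob.\<close>

lemma step_phase: "phase \<kappa>' x \<le> phase \<kappa> x + of_bool (x \<in> introduces ev)"
  using step
proof (cases rule: step.cases)
  case (spawn A \<Phi> B y z)
  then show ?thesis by (auto simp: phase_def facts_Some)
next
  case (send A \<Phi> y yzs)
  then show ?thesis by (auto simp: phase_def facts_Some)
next
  case (receive B \<Phi> w R)
  then show ?thesis
    using pending_consume[OF receive(4), of "carries x" "owner x"]
      pending_consume[OF receive(4), of "releases x" "target x"]
    by (auto simp: phase_def facts_Some split: option.splits)
next
  case (info C \<Phi> y z B)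
  then show ?thesis
    using pending_consume[OF info(4), of "carries x" "owner x"]
      pending_consume[OF info(4), of "releases x" "target x"] by (auto simp: phase_def facts_Some)
next
  case (release B \<Phi> y n)
  then show ?thesis
    using pending_consume[OF release(4), of "carries x" "owner x"]
      pending_consume[OF release(4), of "releases x" "target x"] by (auto simp: phase_def facts_Some)
next
  case (out B w R)
  then show ?thesis
    using pending_consume[OF out(4), of "carries x" "owner x"]
      pending_consume[OF out(4), of "releases x" "target x"] by (auto simp: phase_def facts_Some)
next
  case (release_out B y n)
  then show ?thesis
    using pending_consume[OF release_out(4), of "carries x" "owner x"]
      pending_consume[OF release_out(4), of "releases x" "target x"] by (auto simp: phase_def facts_Some)
next
  case (info_out C y z B)
  then show ?thesis
    using pending_consume[OF info_out(4), of "carries x" "owner x"]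
      pending_consume[OF info_out(4), of "releases x" "target x"] by (auto simp: phase_def facts_Some)
next
  case (send_release A \<Phi> y n)
  then show ?thesis by (cases "x = y") (simp_all add: phase_def facts_Some)
qed (auto simp: phase_def facts_Some)

lemma step_phase_used: "token x \<in> U \<Longrightarrow> phase \<kappa>' x \<le> phase \<kappa> x"
  using step_phase[of x] introduces_fresh[OF step, of x] by (cases "x \<in> introduces ev") auto

text \<open>Deactivation is excluded because it erases the send count. In the same way
  \<open>step_rcount\<close> excludes compaction, which erases the receive count.\<close>

lemma step_scount:
  assumes "\<And>A n. ev \<noteq> SendRelease A x n"
  shows "scount (facts \<kappa>' (owner x)) x = scount (facts \<kappa> (owner x)) x + of_bool (sent_along x ev)"
  using step
proof (cases rule: step.cases)
  case (spawn A \<Phi> B y z)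
  then show ?thesis by (auto simp: facts_Some count_eq_0)
next
  case (receive B \<Phi> w R)
  then show ?thesis using counts_unique_state[of B \<Phi>] by (auto simp: facts_Some split: option.splits)
next
  case (send A \<Phi> y yzs)
  then show ?thesis using counts_unique_state[of A \<Phi>] by (auto simp: facts_Some)
next
  case (send_info A \<Phi> y z)
  then show ?thesis
    using counts_unique_state[of A \<Phi>] by (auto simp: facts_Some)
next
  case (info C \<Phi> y z B)
  then show ?thesis using counts_unique_state[of C \<Phi>] by (auto simp: facts_Some)
next
  case (send_release A \<Phi> y n)
  then have "x \<noteq> y" using assms by blast
  then show ?thesis using send_release by (auto simp: facts_Some)
qed (auto simp: facts_Some)

lemma step_rcount:
  assumes "\<And>C. ev \<noteq> Compaction C x"
  shows "rcount (facts \<kappa>' (target x)) x = rcount (facts \<kappa> (target x)) x + of_bool (received_along x ev)"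
  using step
proof (cases rule: step.cases)
  case (spawn A \<Phi> B y z)
  then show ?thesis by (auto simp: facts_Some count_eq_0)
next
  case (send A \<Phi> y yzs)
  then show ?thesis using counts_unique_state[of A \<Phi>] by (auto simp: facts_Some)
next
  case (receive B \<Phi> w R)
  then show ?thesis
    using counts_unique_state[of B \<Phi>] locatedD(4)[OF located, of "App w R" B]
    by (auto simp: facts_Some split: option.splits)
next
  case (send_info A \<Phi> y z)
  then show ?thesis using counts_unique_state[of A \<Phi>] by (auto simp: facts_Some)
next
  case (info C \<Phi> y z B)
  then show ?thesis
    using counts_unique_state[of C \<Phi>] locatedD(4)[OF located, of "InfoMsg y z B" C]
    by (auto simp: facts_Some)
next
  case (compaction C \<Phi> y)
  then have "x \<noteq> y" using assms by blast
  then show ?thesis using compaction by (auto simp: facts_Some)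
qed (use assms in \<open>auto simp: facts_Some\<close>)

text \<open>Sending adds one message along \<open>x\<close> and receipt removes one. The target is
  not external because \<open>Out\<close> and \<open>InfoOut\<close> remove messages without a
  receipt.\<close>

lemma step_inflight:
  assumes "target x \<notin> externals \<kappa>"
  shows "inflight \<kappa>' x + of_bool (received_along x ev) = inflight \<kappa> x + of_bool (sent_along x ev)"
  using step
proof (cases rule: step.cases)
  case (receive B \<Phi> w R)
  then show ?thesis
    using pending_consume[OF receive(4), of "along x" "target x"] locatedD(4)[OF located receive(4)]
    by auto
next
  case (info C \<Phi> y z B)
  then show ?thesis
    using pending_consume[OF info(4), of "along x" "target x"] locatedD(4)[OF located info(4)]
    by auto
next
  case (release B \<Phi> y n)
  then show ?thesis
    using pending_consume[OF release(4), of "along x" "target x"] by auto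
next
  case (out B w R)
  then show ?thesis
    using pending_consume[OF out(4), of "along x" "target x"] assms by auto
next
  case (release_out B y n)
  then show ?thesis
    using pending_consume[OF release_out(4), of "along x" "target x"] by auto
next
  case (info_out C y z B)
  then show ?thesis
    using pending_consume[OF info_out(4), of "along x" "target x"] assms by auto
qed auto

lemma step_sent_along: "sent_along x ev \<Longrightarrow> active \<kappa> x"
  using step
proof (cases rule: step.cases)
  case (send_info A \<Phi> y z)
  then show "sent_along x ev \<Longrightarrow> active \<kappa> x"
    using locatedD(7)[OF located, of y z] by (auto simp: facts_Some)
qed (auto simp: facts_Some entails_simps)

lemma step_received_along: "received_along x ev \<Longrightarrow> inflight \<kappa> x > 0"
  using step
proof (cases rule: step.cases)
  case (receive B \<Phi> w R)
  then show "received_along x ev \<Longrightarrow> inflight \<kappa> x > 0"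
    using locatedD(4)[OF located receive(4)] by (auto intro!: pending_pos)
next
  case (info C \<Phi> y z B)
  then show "received_along x ev \<Longrightarrow> inflight \<kappa> x > 0"
    using locatedD(4)[OF located info(4)] by (auto intro!: pending_pos)
qed auto

lemma step_send_release:
  assumes "ev = SendRelease A x n"
  shows "active \<kappa> x" "\<not> active \<kappa>' x" "n = scount (facts \<kappa> (owner x)) x" "releasing \<kappa>' x > 0"
    "\<And>z. CreatedUsing x z \<notin> facts \<kappa> (owner x)"
proof -
  have "active \<kappa> x \<and> \<not> active \<kappa>' x \<and> n = scount (facts \<kappa> (owner x)) x \<and> releasing \<kappa>' x > 0
      \<and> (\<forall>z. CreatedUsing x z \<notin> facts \<kappa> (owner x))"
    using step
  proof (cases rule: step.cases)
    case (send_release B \<Phi> y m)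
    then show ?thesis
      using assms entails_count(1)[OF counts_unique_state[of B \<Phi>], of y m] by (simp add: facts_Some)
  qed (use assms in simp_all)
  then show "active \<kappa> x" "\<not> active \<kappa>' x" "n = scount (facts \<kappa> (owner x)) x" "releasing \<kappa>' x > 0"
    "\<And>z. CreatedUsing x z \<notin> facts \<kappa> (owner x)" by simp_all
qed

lemma step_compaction:
  assumes "ev = Compaction C x"
  shows "Released x \<in> facts \<kappa> (target x)"
  using step assms by (cases rule: step.cases) (auto simp: facts_Some)

lemma step_deactivates:
  assumes "active \<kappa> x" "\<not> active \<kappa>' x"
  obtains n where "ev = SendRelease (owner x) x n"
  using step
proof (cases rule: step.cases)
  case (spawn A \<Phi> B y z)
  then show thesis using assms by (auto simp: facts_Some split: if_splits)
qed (use assms that in \<open>auto simp: facts_Some split: if_splits option.splits\<close>)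

text \<open>The used token rules out an introduction by \<open>Spawn\<close>, so the activation
  comes from a received message that carries \<open>x\<close>.\<close>

lemma step_activates:
  assumes "active \<kappa>' x" "\<not> active \<kappa> x" "token x \<in> U"
  shows "transit \<kappa> x > 0"
  using step
proof (cases rule: step.cases)
  case (receive B \<Phi> w R)
  then show ?thesis
    using assms locatedD(4)[OF located receive(4)]
    by (auto simp: facts_Some split: if_splits option.splits intro!: pending_pos)
qed (use assms in \<open>auto simp: facts_Some split: if_splits option.splits\<close>)

lemma step_transit:
  assumes "transit \<kappa>' x > 0" "token x \<in> U"
  shows "transit \<kappa> x > 0"
proof -
  have "transit \<kappa>' x \<le> transit \<kappa> x"
    using step
  proof (cases rule: step.cases)
    case (receive B \<Phi> w R)
    then show ?thesis using pending_consume[OF receive(4), of "carries x" "owner x"] by auto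
  next
    case (info C \<Phi> y z B)
    then show ?thesis using pending_consume[OF info(4), of "carries x" "owner x"] by auto
  next
    case (release B \<Phi> y n)
    then show ?thesis using pending_consume[OF release(4), of "carries x" "owner x"] by auto
  next
    case (out B w R)
    then show ?thesis using pending_consume[OF out(4), of "carries x" "owner x"] by auto
  next
    case (release_out B y n)
    then show ?thesis using pending_consume[OF release_out(4), of "carries x" "owner x"] by auto
  next
    case (info_out C y z B)
    then show ?thesis using pending_consume[OF info_out(4), of "carries x" "owner x"] by auto
  qed (use assms(2) in auto)
  then show ?thesis using assms(1) by simp
qed

lemma step_release_message:
  assumes "ReleaseMsg x n \<in># msgs \<kappa>' (target x)"
  shows "ReleaseMsg x n \<in># msgs \<kappa> (target x) \<or> (\<exists>A. ev = SendRelease A x n)"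
  using step assms by (cases rule: step.cases) (auto split: if_splits dest: in_diffD)

text \<open>At a target that is not external, only the rule \<open>Release\<close> removes release
  messages, and its guard equates the announced count with the receive count.\<close>

lemma step_release_consumed:
  assumes "ReleaseMsg x n \<in># msgs \<kappa> (target x)" "releasing \<kappa>' x = 0" "target x \<notin> externals \<kappa>"
    "releasing \<kappa> x \<le> 1"
  shows "ev = Release (target x) x n" "rcount (facts \<kappa> (target x)) x = n"
proof -
  have gone: "ReleaseMsg x n \<notin># msgs \<kappa>' (target x)"
    using assms(2) by (auto simp: pending_eq_0_iff)
  have "ev = Release (target x) x n \<and> rcount (facts \<kappa> (target x)) x = n"
    using step
  proof (cases rule: step.cases)
    case (release B \<Phi> y m)
    then show ?thesis
      using gone assms(1)
        entails_count(2)[OF counts_unique_state, of B \<Phi> y m]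
      by (auto simp: facts_Some split: if_splits simp: in_diff_count)
  qed (use assms gone in \<open>auto simp: in_diff_count split: if_splits\<close>)
  then show "ev = Release (target x) x n" "rcount (facts \<kappa> (target x)) x = n" by simp_all
qed

end


section \<open>Conservation of messages along a refob\<close>

text \<open>What was sent has been received or is in flight, phase by phase. After deactivation, the
  number in the release message takes over from the erased send count.\<close>

definition balanced :: "('t, 'a) config \<Rightarrow> ('t, 'a) refob \<Rightarrow> bool" where
  "balanced \<kappa> x \<longleftrightarrow>
     (active \<kappa> x \<longrightarrow> scount (facts \<kappa> (owner x)) x = rcount (facts \<kappa> (target x)) x + inflight \<kappa> x)
   \<and> (\<forall>n. ReleaseMsg x n \<in># msgs \<kappa> (target x) \<longrightarrow> n = rcount (facts \<kappa> (target x)) x + inflight \<kappa> x)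
   \<and> (\<not> active \<kappa> x \<and> releasing \<kappa> x = 0 \<longrightarrow> inflight \<kappa> x = 0)
   \<and> (transit \<kappa> x > 0 \<longrightarrow> rcount (facts \<kappa> (target x)) x = 0)"

text \<open>The bound 1 on \<open>phase\<close> says that the phases exclude each other. External
  targets are exempt from \<open>balanced\<close> because messages to them vanish without being
  counted as received.\<close>

definition coherent :: "('t, 'a) config \<Rightarrow> bool" where
  "coherent \<kappa> \<longleftrightarrow> located \<kappa> \<and> (\<forall>x. phase \<kappa> x \<le> 1)
     \<and> (\<forall>x. Released x \<in> facts \<kappa> (target x) \<longrightarrow> phase \<kappa> x = 0)
     \<and> (\<forall>x. target x \<notin> externals \<kappa> \<longrightarrow> balanced \<kappa> x)"

lemma coherentD:
  assumes "coherent \<kappa>"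
  shows "located \<kappa>" "phase \<kappa> x \<le> 1" "Released x \<in> facts \<kappa> (target x) \<Longrightarrow> phase \<kappa> x = 0"
    "target x \<notin> externals \<kappa> \<Longrightarrow> balanced \<kappa> x"
  using assms unfolding coherent_def by auto

lemma releasing_pos:
  assumes "located \<kappa>" "releasing \<kappa> x > 0"
  obtains n where "ReleaseMsg x n \<in># msgs \<kappa> (target x)"
proof -
  obtain m where "m \<in># msgs \<kappa> (target x)" "releases x m"
    using assms(2) pending_eq_0_iff[of "releases x" "target x" \<kappa>] by auto
  then show thesis using that by (cases m) auto
qed

lemma inactive_scount:
  assumes "located \<kappa>" "\<not> active \<kappa> x"
  shows "scount (facts \<kappa> (owner x)) x = 0"
  using locatedD(6)[OF assms(1)] assms(2) by (metis count_eq_0(1))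

lemma fresh_idle:
  assumes "token x \<notin> tokens \<kappa>"
  shows "phase \<kappa> x = 0" "scount (facts \<kappa> A) x = 0" "rcount (facts \<kappa> A) x = 0"
    "pending (along x) A \<kappa> = 0"
proof -
  have "\<not> carries x m \<and> \<not> along x m \<and> \<not> releases x m" if "m \<in># msgs \<kappa> A" for m A
    using fresh(2)[OF assms that] by (cases m) auto
  then have no_message: "pending (carries x) A \<kappa> = 0" "pending (along x) A \<kappa> = 0"
      "pending (releases x) A \<kappa> = 0" for A
    by (auto simp: pending_eq_0_iff)
  moreover have "Activated x \<notin> facts \<kappa> A" "SentCount x n \<notin> facts \<kappa> A" "RecvCount x n \<notin> facts \<kappa> A" for A n
    using fresh(1)[OF assms, of "Activated x"] fresh(1)[OF assms, of "SentCount x n"]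
      fresh(1)[OF assms, of "RecvCount x n"] by auto
  ultimately show "phase \<kappa> x = 0" "scount (facts \<kappa> A) x = 0" "rcount (facts \<kappa> A) x = 0"
    "pending (along x) A \<kappa> = 0"
    by (simp_all add: phase_def count_eq_0)
qed

section \<open>Chains of references\<close>

text \<open>The phase of a refob with an external owner is \<open>0\<close> once the refob has been delivered, but
  external actors never release anything.\<close>

definition live :: "('t, 'a) config \<Rightarrow> ('t, 'a) refob \<Rightarrow> bool" where
  "live \<kappa> x \<longleftrightarrow> phase \<kappa> x > 0 \<or> owner x \<in> externals \<kappa>"

definition link :: "('t, 'a) config \<Rightarrow> ('t, 'a) refob \<Rightarrow> ('t, 'a) refob \<Rightarrow> bool" where
  "link \<kappa> y x \<longleftrightarrow> CreatedUsing y x \<in> facts \<kappa> (owner y) \<or> (\<exists>A B. InfoMsg y x B \<in># msgs \<kappa> A)"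

inductive chain :: "('t, 'a) config \<Rightarrow> ('t, 'a) refob \<Rightarrow> bool" for \<kappa> where
  created: "live \<kappa> x \<Longrightarrow> Created x \<in> facts \<kappa> (target x) \<Longrightarrow> chain \<kappa> x"
| link: "chain \<kappa> y \<Longrightarrow> link \<kappa> y x \<Longrightarrow> live \<kappa> x \<Longrightarrow> chain \<kappa> x"

text \<open>Every refob with an external owner is \<open>live\<close>, even one that was never
  created, so the first clause asks for positive phase instead.\<close>

definition chained :: "('t, 'a) config \<Rightarrow> bool" where
  "chained \<kappa> \<longleftrightarrow>
     (\<forall>x. phase \<kappa> x > 0 \<and> target x \<notin> externals \<kappa> \<longrightarrow> chain \<kappa> x \<or> target x \<in> receptionists \<kappa>)
   \<and> (\<forall>B \<in> receptionists \<kappa>. \<exists>x. target x = B \<and> owner x \<in> externals \<kappa> \<and> chain \<kappa> x)"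

lemma chain_live: "chain \<kappa> x \<Longrightarrow> live \<kappa> x"
  by (auto elim: chain.cases)

lemma link_target:
  assumes "located \<kappa>" "link \<kappa> y x"
  shows "target x = target y"
  using assms(2) locatedD(3)[OF assms(1), of "CreatedUsing y x"]
    locatedD(4)[OF assms(1), of "InfoMsg y x B" for B]
  unfolding link_def by fastforce

lemma link_token:
  assumes "link \<kappa> y x"
  shows "token y \<in> tokens \<kappa>" "token x \<in> tokens \<kappa>"
proof -
  consider A where "CreatedUsing y x \<in> facts \<kappa> A" | A B where "InfoMsg y x B \<in># msgs \<kappa> A"
    using assms unfolding link_def by blast
  then have "token y \<in> tokens \<kappa> \<and> token x \<in> tokens \<kappa>"
  proof cases
    case 1
    show ?thesis using fresh(1)[OF _ 1] by fastforce
  next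
    case 2
    show ?thesis using fresh(2)[OF _ 2] by fastforce
  qed
  then show "token y \<in> tokens \<kappa>" "token x \<in> tokens \<kappa>" by simp_all
qed

lemma chain_token: "chain \<kappa> x \<Longrightarrow> token x \<in> tokens \<kappa>"
proof (induction rule: chain.induct)
  case (created x)
  then show ?case using fresh(1)[of x \<kappa> "Created x"] by auto
next
  case (link y x)
  then show ?case using link_token(2) by blast
qed

section \<open>Preservation of coherence and of chains by one event\<close>

context
  fixes U :: "'t set" and \<kappa> \<kappa>' :: "('t, 'a) config" and ev :: "('t, 'a) event"
  assumes step: "step U \<kappa> ev \<kappa>'" and coherent: "coherent \<kappa>"
begin

lemmas located = coherentD(1)[OF coherent]

context
  assumes used: "tokens \<kappa> \<subseteq> U"
begin

text \<open>A refob with a used token cannot be introduced again, and one with a fresh token starts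
  from phase 0.\<close>

lemma step_phase_le: "phase \<kappa>' x \<le> 1"
proof (cases "token x \<in> U")
  case True
  then show ?thesis using step_phase_used[OF step located, of x] coherentD(2)[OF coherent, of x] by simp
next
  case False
  then have "phase \<kappa> x = 0" using fresh_idle(1)[of x \<kappa>] used by blast
  then show ?thesis using step_phase[OF step located, of x] by (simp add: of_bool_def split: if_splits)
qed

lemma step_release:
  assumes "Released x \<in> facts \<kappa>' (target x)" "Released x \<notin> facts \<kappa> (target x)"
  shows "releasing \<kappa> x > 0" "phase \<kappa>' x < phase \<kappa> x"
proof -
  have "releasing \<kappa> x > 0 \<and> phase \<kappa>' x < phase \<kappa> x"
    using step
  proof (cases rule: step.cases)
    case (release B \<Phi> y n)
    then have "y = x" using assms by (auto simp: facts_Some split: if_splits)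
    moreover have "target x = B"
      using \<open>y = x\<close> locatedD(4)[OF located release(4)] by simp
    ultimately show ?thesis
      using release pending_consume[OF release(4), of "carries x" "owner x"]
        pending_consume[OF release(4), of "releases x" "target x"]
        pending_pos[OF release(4), of "releases x"]
      by (auto simp: phase_def facts_Some)
  qed (use assms in \<open>auto simp: facts_Some split: if_splits option.splits\<close>)
  then show "releasing \<kappa> x > 0" "phase \<kappa>' x < phase \<kappa> x" by simp_all
qed

text \<open>An old \<open>Released\<close> fact means a used token and phase 0, which cannot rise. A
  new one comes with the consumption of a release message, and that was the only unit of
  phase.\<close>

lemma step_released:
  assumes "Released x \<in> facts \<kappa>' (target x)"
  shows "phase \<kappa>' x = 0"
proof (cases "Released x \<in> facts \<kappa> (target x)")
  case True
  then have "token x \<in> U" using fresh(1)[of x \<kappa> "Released x"] used by auto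
  then show ?thesis
    using step_phase_used[OF step located, of x] coherentD(3)[OF coherent True] by simp
next
  case False
  then show ?thesis
    using step_release(2)[OF assms] coherentD(2)[OF coherent, of x] by simp
qed

lemma step_balanced:
  assumes "target x \<notin> externals \<kappa>'"
  shows "balanced \<kappa>' x"
proof -
  define s where "s = scount (facts \<kappa> (owner x)) x"
  define r where "r = rcount (facts \<kappa> (target x)) x"
  define i where "i = inflight \<kappa> x"
  define s' where "s' = scount (facts \<kappa>' (owner x)) x"
  define r' where "r' = rcount (facts \<kappa>' (target x)) x"
  define i' where "i' = inflight \<kappa>' x"
  have internal: "target x \<notin> externals \<kappa>"
    using assms step_mono(2)[OF step] by blast
  note balanced = coherentD(4)[OF coherent internal, unfolded balanced_def, folded s_def r_def i_def]
  have phase: "transit \<kappa> x + of_bool (active \<kappa> x) + releasing \<kappa> x \<le> 1"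
    using coherentD(2)[OF coherent, of x] by (simp add: phase_def)
  have fresh_zero: "s = 0 \<and> r = 0 \<and> i = 0 \<and> transit \<kappa> x = 0 \<and> \<not> active \<kappa> x \<and> releasing \<kappa> x = 0"
    if "token x \<notin> U"
    using that used fresh_idle[of x \<kappa>] by (auto simp: s_def r_def i_def phase_def)
  \<comment> \<open>A refob that is active after the event was not deactivated by it, so its send
    count was not erased.\<close>
  have s': "s' = s + of_bool (sent_along x ev)" if "active \<kappa>' x"
    using step_scount[OF step located, of x] step_send_release(2)[OF step located] that
    unfolding s_def s'_def by blast
  have i': "i' + of_bool (received_along x ev) = i + of_bool (sent_along x ev)"
    using step_inflight[OF step located internal] unfolding i_def i'_def .
  \<comment> \<open>Compaction of \<open>x\<close> needs a \<open>Released\<close> fact, hence phase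
    0 before the event and, the token being used, also after it.\<close>
  have r': "r' = r + of_bool (received_along x ev)" if "phase \<kappa>' x > 0"
  proof -
    have "ev \<noteq> Compaction C x" for C
    proof
      assume "ev = Compaction C x"
      then have released: "Released x \<in> facts \<kappa> (target x)"
        using step_compaction[OF step located] by blast
      then have "token x \<in> U" using fresh(1)[of x \<kappa> "Released x"] used by auto
      then show False
        using that step_phase_used[OF step located, of x] coherentD(3)[OF coherent released] by simp
    qed
    then show ?thesis
      using step_rcount[OF step located] unfolding r_def r'_def by blast
  qed
  have sent: "sent_along x ev \<Longrightarrow> active \<kappa> x"
    using step_sent_along[OF step located] .
  have received: "received_along x ev \<Longrightarrow> i > 0"
    using step_received_along[OF step located] unfolding i_def .
  have inactive: "\<not> active \<kappa> x \<Longrightarrow> s = 0"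
    using inactive_scount[OF located] unfolding s_def .
  have "s' = r' + i'" if "active \<kappa>' x"
  proof -
    have "s = r + i"
    proof (cases "active \<kappa> x")
      case False
      \<comment> \<open>A refob that becomes active was in transit or is new; in both cases nothing
        has been sent or received along it.\<close>
      then have "transit \<kappa> x > 0 \<or> token x \<notin> U"
        using step_activates[OF step located that] by blast
      then show ?thesis using False fresh_zero balanced phase inactive by auto
    qed (use balanced in blast)
    moreover have "phase \<kappa>' x > 0" using that by (simp add: phase_def)
    ultimately show ?thesis using s'[OF that] r' i' by linarith
  qed
  moreover have "n = r' + i'" if message: "ReleaseMsg x n \<in># msgs \<kappa>' (target x)" for n
  proof -
    have "releasing \<kappa>' x > 0" using pending_pos[OF message] by simp
    then have "phase \<kappa>' x > 0" by (simp add: phase_def)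
    \<comment> \<open>An old release message means that the refob is inactive, so nothing more is
      sent along it. A new one announces the send count, which the first clause of balance equates
      with \<open>r + i\<close>.\<close>
    moreover have "n = r + i \<and> \<not> sent_along x ev"
      using step_release_message[OF step located message]
    proof
      assume old: "ReleaseMsg x n \<in># msgs \<kappa> (target x)"
      then have "releasing \<kappa> x > 0" using pending_pos[OF old] by simp
      then show ?thesis using old balanced phase sent by auto
    next
      assume "\<exists>A. ev = SendRelease A x n"
      then obtain A where "ev = SendRelease A x n" by blast
      then show ?thesis
        using step_send_release[OF step located] balanced unfolding s_def by auto
    qed
    ultimately show ?thesis using r' i' by auto
  qed
  moreover have "i' = 0" if ended: "\<not> active \<kappa>' x" "releasing \<kappa>' x = 0"
  proof -
    have "\<not> active \<kappa> x"
    proof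
      assume "active \<kappa> x"
      then obtain n where "ev = SendRelease (owner x) x n"
        using step_deactivates[OF step located _ ended(1)] by blast
      then show False using step_send_release(4)[OF step located] ended(2) by simp
    qed
    \<comment> \<open>If a release message was consumed by this event, its count equals
      \<open>r\<close> by the guard of \<open>Release\<close> and \<open>r + i\<close> by
      balance.\<close>
    moreover have "i = 0"
    proof (cases "releasing \<kappa> x = 0")
      case False
      then obtain n where message: "ReleaseMsg x n \<in># msgs \<kappa> (target x)"
        using releasing_pos[OF located] by blast
      then have "r = n"
        using step_release_consumed(2)[OF step located message ended(2) internal] phase
        unfolding r_def by simp
      then show ?thesis using balanced message by auto
    qed (use balanced \<open>\<not> active \<kappa> x\<close> in blast)
    ultimately show ?thesis using i' sent by (cases "sent_along x ev") auto
  qed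
  moreover have "r' = 0" if "transit \<kappa>' x > 0"
  proof -
    have "phase \<kappa>' x > 0" using that by (simp add: phase_def)
    moreover have "r = 0 \<and> i = 0"
    proof (cases "token x \<in> U")
      case True
      then have "transit \<kappa> x > 0" using step_transit[OF step located that] by blast
      then show ?thesis using balanced phase by auto
    qed (use fresh_zero in blast)
    ultimately show ?thesis using r' received by auto
  qed
  ultimately show ?thesis
    unfolding balanced_def s'_def r'_def i'_def by blast
qed

lemma step_coherent: "coherent \<kappa>'"
  unfolding coherent_def
  using step_located[OF step located] step_phase_le step_released step_balanced by blast

end

text \<open>A carrying message disappears either by receipt, which activates \<open>x\<close>, or by
  \<open>Out\<close>, in which case the owner is external.\<close>

lemma step_transit_consumed:
  assumes "transit \<kappa> x > 0" "transit \<kappa>' x = 0"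
  shows "active \<kappa>' x \<or> owner x \<in> externals \<kappa>"
  using step
proof (cases rule: step.cases)
  case (receive B \<Phi> w R)
  show ?thesis
  proof (cases "x \<in> R")
    case True
    then show ?thesis using receive locatedD(4)[OF located receive(4)] by simp
  next
    case False
    then show ?thesis
      using assms receive pending_consume[OF receive(4), of "carries x" "owner x"] by simp
  qed
next
  case (out B w R)
  show ?thesis
  proof (cases "x \<in> R")
    case True
    then show ?thesis using out locatedD(4)[OF located out(4)] by simp
  next
    case False
    then show ?thesis
      using assms out pending_consume[OF out(4), of "carries x" "owner x"] by simp
  qed
next
  case (info C \<Phi> y z B)
  then show ?thesis
    using assms pending_consume[OF info(4), of "carries x" "owner x"] by simp
next
  case (release B \<Phi> y n)
  then show ?thesis
    using assms pending_consume[OF release(4), of "carries x" "owner x"] by simp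
next
  case (release_out B y n)
  then show ?thesis
    using assms pending_consume[OF release_out(4), of "carries x" "owner x"] by simp
next
  case (info_out C y z B)
  then show ?thesis
    using assms pending_consume[OF info_out(4), of "carries x" "owner x"] by simp
qed (use assms in simp_all)

text \<open>A refob with an internal owner could die only by consumption of its release message. The
  guard of \<open>Release\<close> and balance then leave no info message in flight along it, and
  being inactive it has no \<open>CreatedUsing\<close> fact, so it could not have a link to
  \<open>x\<close>.\<close>

lemma step_live:
  assumes "live \<kappa> y" "link \<kappa> y x" "target y \<notin> externals \<kappa>"
  shows "live \<kappa>' y"
proof (rule ccontr)
  assume dead: "\<not> live \<kappa>' y"
  then have "owner y \<notin> externals \<kappa>"
    using step_mono(2)[OF step] by (auto simp: live_def)
  then have phase: "phase \<kappa> y = 1"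
    using assms(1) coherentD(2)[OF coherent, of y] by (simp add: live_def)
  have ended: "transit \<kappa>' y = 0" "\<not> active \<kappa>' y" "releasing \<kappa>' y = 0"
    using dead by (auto simp: live_def phase_def)
  have inactive: "\<not> active \<kappa> y"
  proof
    assume "active \<kappa> y"
    then obtain n where "ev = SendRelease (owner y) y n"
      using step_deactivates[OF step located _ ended(2)] by blast
    then show False using step_send_release(4)[OF step located] ended(3) by simp
  qed
  moreover have "transit \<kappa> y = 0"
    using step_transit_consumed ended \<open>owner y \<notin> externals \<kappa>\<close> by blast
  ultimately have "releasing \<kappa> y = 1"
    using phase by (simp add: phase_def)
  then obtain n where message: "ReleaseMsg y n \<in># msgs \<kappa> (target y)"
    using releasing_pos[OF located, of y] by auto
  have "rcount (facts \<kappa> (target y)) y = n"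
    using step_release_consumed(2)[OF step located message ended(3) assms(3)] \<open>releasing \<kappa> y = 1\<close> by simp
  then have "inflight \<kappa> y = 0"
    using coherentD(4)[OF coherent assms(3)] message by (auto simp: balanced_def)
  moreover have "CreatedUsing y x \<notin> facts \<kappa> (owner y)"
    using locatedD(7)[OF located] inactive by blast
  ultimately show False
    using assms(2) locatedD(4)[OF located, of "InfoMsg y x B" for B]
    by (fastforce simp: link_def pending_eq_0_iff)
qed

text \<open>Only compaction erases \<open>Created\<close> facts, and it requires a
  \<open>Released\<close> fact; a released refob has phase 0 and an internal owner, so it is not
  live.\<close>

lemma step_created:
  assumes "Created x \<in> facts \<kappa> (target x)" "live \<kappa> x"
  shows "Created x \<in> facts \<kappa>' (target x)"
proof -
  have "ev \<noteq> Compaction C x" for C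
  proof
    assume "ev = Compaction C x"
    then have released: "Released x \<in> facts \<kappa> (target x)"
      using step_compaction[OF step located] by blast
    then show False
      using assms(2) coherentD(3)[OF coherent released] locatedD(1)[OF located]
        locatedD(3)[OF located released] by (auto simp: live_def)
  qed
  with step show ?thesis
  proof (cases rule: step.cases)
    case (spawn A \<Phi> B y z)
    then show ?thesis using assms(1) facts_Some(3)[of B \<kappa>] by (auto simp: facts_Some(1,2))
  next
    case (compaction C \<Phi> y)
    then have "x \<noteq> y" using \<open>\<And>C. ev \<noteq> Compaction C x\<close> by blast
    then show ?thesis using compaction assms(1) by (auto simp: facts_Some)
  qed (use assms(1) in \<open>auto simp: facts_Some split: option.splits\<close>)
qed

text \<open>\<open>SendInfo\<close> turns the recorded link into a message, and \<open>Info\<close>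
  turns the message into a \<open>Created\<close> fact, from which a chain can start anew.\<close>

lemma step_link:
  assumes "link \<kappa> y x" "target x \<notin> externals \<kappa>"
  shows "link \<kappa>' y x \<or> Created x \<in> facts \<kappa>' (target x)"
proof -
  consider "CreatedUsing y x \<in> facts \<kappa> (owner y)" | A B where "InfoMsg y x B \<in># msgs \<kappa> A"
    using assms(1) by (auto simp: link_def)
  then show ?thesis
  proof cases
    case 1
    show ?thesis
      using step
    proof (cases rule: step.cases)
      case (spawn A \<Phi> B u v)
      then show ?thesis using 1 facts_Some(3)[of B \<kappa>] by (auto simp: link_def facts_Some(1,2))
    next
      case (send_info A \<Phi> u v)
      show ?thesis
      proof (cases "u = y \<and> v = x")
        case True
        then have "InfoMsg y x (owner x) \<in># msgs \<kappa>' (target u)" using send_info by simp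
        then show ?thesis unfolding link_def by blast
      next
        case False
        then show ?thesis using send_info 1 by (auto simp: link_def facts_Some)
      qed
    qed (use 1 in \<open>auto simp: link_def facts_Some split: option.splits\<close>)
  next
    case (2 A B)
    have target: "target x = A" using locatedD(4)[OF located 2] by simp
    have "InfoMsg y x B \<in># msgs \<kappa>' A \<or> Created x \<in> facts \<kappa>' (target x)"
      using step
    proof (cases rule: step.cases)
      case (info C \<Phi> u v D)
      then show ?thesis
        using 2 target by (cases "C = A \<and> u = y \<and> v = x") (auto simp: in_diff_count)
    next
      case (info_out C u v D)
      then show ?thesis using 2 assms(2) target by auto
    qed (use 2 in \<open>auto simp: in_diff_count\<close>)
    then show ?thesis unfolding link_def by blast
  qed
qed

text \<open>Liveness after the event is assumed for the last refob only: each earlier one is kept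
  alive by its link to the next (\<open>step_live\<close>).\<close>

lemma step_chain:
  assumes "chain \<kappa> x" "target x \<notin> externals \<kappa>" "live \<kappa>' x"
  shows "chain \<kappa>' x"
  using assms
proof induction
  case (created x)
  then show ?case using step_created chain.created by blast
next
  case (link y x)
  have "target x = target y" using link_target[OF located link.hyps(2)] .
  then have "chain \<kappa>' y"
    using link.IH link.prems step_live[OF chain_live[OF link.hyps(1)] link.hyps(2)] by simp
  then show ?case
    using step_link[OF link.hyps(2) link.prems(1)] link.prems(2) chain.created chain.link by blast
qed

text \<open>\<open>Spawn\<close> starts new chains, \<open>Send\<close> links each new refob to the
  active one it was created from, and refobs from outside target receptionists or external
  actors.\<close>

lemma step_new_refob:
  assumes "phase \<kappa>' x > 0" "phase \<kappa> x = 0"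
  shows "Created x \<in> facts \<kappa>' (target x) \<or> target x \<in> externals \<kappa>' \<or> target x \<in> receptionists \<kappa>'
    \<or> (\<exists>y. link \<kappa>' y x \<and> active \<kappa> y \<and> active \<kappa>' y \<and> target y = target x)"
proof -
  have "x \<in> introduces ev"
    using assms step_phase[OF step located, of x] by (auto simp: of_bool_def split: if_splits)
  with step show ?thesis
  proof (cases rule: step.cases)
    case (spawn A \<Phi> B y z)
    then show ?thesis using \<open>x \<in> introduces ev\<close> by auto
  next
    case (send A \<Phi> u yzs)
    then obtain y where y: "(y, x) \<in> set yzs" using \<open>x \<in> introduces ev\<close> by auto
    then have "link \<kappa>' y x \<and> active \<kappa> y \<and> active \<kappa>' y \<and> target y = target x"
      using send by (auto simp: link_def facts_Some entails_simps)
    then show ?thesis by blast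
  next
    case ("in" A R)
    then show ?thesis using \<open>x \<in> introduces ev\<close> by auto
  qed simp_all
qed

text \<open>Receptionists arise only by \<open>Out\<close>. The delivered refob is still in transit
  before the event, so \<open>chained\<close> can supply its chain there; its external owner keeps
  it live afterwards.\<close>

lemma step_new_receptionist:
  assumes "B \<in> receptionists \<kappa>'" "B \<notin> receptionists \<kappa>"
  shows "\<exists>x. target x = B \<and> owner x \<in> externals \<kappa> \<and> phase \<kappa> x > 0"
  using step
proof (cases rule: step.cases)
  case (out E w R)
  then obtain x where "x \<in> R" "target x = B" using assms by auto
  moreover have "owner x = E"
    using \<open>x \<in> R\<close> locatedD(4)[OF located out(4)] by simp
  moreover have "transit \<kappa> x > 0"
    using pending_pos[OF out(4), of "carries x"] \<open>x \<in> R\<close> \<open>owner x = E\<close> by simp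
  ultimately show ?thesis using out by (auto simp: phase_def)
qed (use assms in simp_all)

lemma step_chained:
  assumes "chained \<kappa>"
  shows "chained \<kappa>'"
proof -
  have refob: "chain \<kappa>' x \<or> target x \<in> receptionists \<kappa>'"
    if live: "phase \<kappa>' x > 0" and internal: "target x \<notin> externals \<kappa>'" for x
  proof -
    have internal': "target x \<notin> externals \<kappa>" using internal step_mono(2)[OF step] by blast
    have known: "chain \<kappa>' y \<or> target x \<in> receptionists \<kappa>'"
      if "phase \<kappa> y > 0" "phase \<kappa>' y > 0" "target y = target x" for y
    proof (cases "chain \<kappa> y")
      case True
      then have "chain \<kappa>' y" using step_chain that internal' by (simp add: live_def)
      then show ?thesis by blast
    next
      case False
      then show ?thesis
        using assms that internal' step_mono(3)[OF step] unfolding chained_def by fastforce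
    qed
    show ?thesis
    proof (cases "phase \<kappa> x > 0")
      case True
      then show ?thesis using known live by blast
    next
      case False
      then have "phase \<kappa> x = 0" by simp
      from step_new_refob[OF live this] internal show ?thesis
      proof (elim disjE exE)
        assume "Created x \<in> facts \<kappa>' (target x)"
        then show ?thesis using live chain.created by (auto simp: live_def)
      next
        fix y
        assume y: "link \<kappa>' y x \<and> active \<kappa> y \<and> active \<kappa>' y \<and> target y = target x"
        then have "chain \<kappa>' y \<or> target x \<in> receptionists \<kappa>'"
          using known by (auto simp: phase_def)
        then show ?thesis using y live chain.link by (auto simp: live_def)
      qed auto
    qed
  qed
  moreover have "\<exists>x. target x = B \<and> owner x \<in> externals \<kappa>' \<and> chain \<kappa>' x"
    if B: "B \<in> receptionists \<kappa>'" for B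
  proof -
    have "B \<notin> externals \<kappa>"
      using B locatedD(1,2)[OF step_located[OF step located]] step_mono(2)[OF step] by blast
    have "\<exists>x. target x = B \<and> owner x \<in> externals \<kappa> \<and> chain \<kappa> x"
    proof (cases "B \<in> receptionists \<kappa>")
      case True
      then show ?thesis using assms by (simp add: chained_def)
    next
      case False
      then show ?thesis
        using step_new_receptionist[OF B False] \<open>B \<notin> externals \<kappa>\<close> assms
        unfolding chained_def by blast
    qed
    then obtain x where x: "target x = B" "owner x \<in> externals \<kappa>" "chain \<kappa> x" by blast
    then have "owner x \<in> externals \<kappa>'" using step_mono(2)[OF step] by blast
    then show ?thesis
      using x step_chain[OF x(3)] \<open>B \<notin> externals \<kappa>\<close> by (auto simp: live_def)
  qed
  ultimately show ?thesis unfolding chained_def by blast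
qed

end


section \<open>The initial configuration\<close>

lemma initial_coherent:
  assumes "initial \<kappa>"
  shows "coherent \<kappa>" "chained \<kappa>"
proof -
  obtain A E x y where AE: "A \<noteq> E" and x: "owner x = A" "target x = E" and y: "owner y = A" "target y = A"
    and \<kappa>: "\<kappa> = \<lparr>actors = [A \<mapsto> BusyWith {Activated x, Created y, Activated y}],
            msgs = (\<lambda>_. {#}), receptionists = {}, externals = {E}\<rparr>"
    using assms unfolding initial_def by blast
  have facts: "facts \<kappa> B = (if B = A then {Activated x, Created y, Activated y} else {})" for B
    by (simp add: facts_def \<kappa>)
  have pending: "pending P B \<kappa> = 0" for P B
    by (simp add: pending_def \<kappa>)
  have msgs: "msgs \<kappa> B = {#}" for B
    by (simp add: \<kappa>)
  have phase: "phase \<kappa> z = of_bool (z = x \<or> z = y)" for z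
    using x y by (auto simp: phase_def facts pending)
  have counts: "scount (facts \<kappa> B) z = 0" "rcount (facts \<kappa> B) z = 0" for B z
    by (simp_all add: facts)
  have "located \<kappa>"
    using AE x y by (auto simp: located_def facts msgs) (auto simp: \<kappa>)
  moreover have "balanced \<kappa> z" for z
    by (simp add: balanced_def counts pending msgs)
  ultimately show "coherent \<kappa>"
    by (simp add: coherent_def phase facts)
  have "chain \<kappa> y"
    using y by (auto intro!: chain.created simp: live_def phase facts)
  then show "chained \<kappa>"
    using x by (auto simp: chained_def phase) (auto simp: \<kappa>)
qed

section \<open>Tracing an active refob back in time\<close>

definition held :: "('t, 'a) config \<Rightarrow> ('t, 'a) refob \<Rightarrow> bool" where
  "held \<kappa> x \<longleftrightarrow> transit \<kappa> x > 0 \<or> active \<kappa> x"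

lemma step_created_using:
  assumes "step U \<kappa> ev \<kappa>'" "located \<kappa>" "CreatedUsing x z \<in> facts \<kappa> (owner x)" "\<not> sent_along x ev"
  shows "CreatedUsing x z \<in> facts \<kappa>' (owner x)"
  using assms(1)
proof (cases rule: step.cases)
  case (spawn A \<Phi> B u v)
  then show ?thesis using assms(3) facts_Some(3)[of B \<kappa>] by (auto simp: facts_Some(1,2))
qed (use assms in \<open>auto simp: facts_Some split: option.splits\<close>)

text \<open>To be read backwards in time. A refob held after the event was not deactivated by it, so
  its send count cannot fall; and a \<open>CreatedUsing\<close> fact is removed only by
  \<open>SendInfo\<close>, which raises that count.\<close>

lemma step_held:
  assumes step: "step U \<kappa> ev \<kappa>'" and coherent: "coherent \<kappa>" and used: "token x \<in> U"
    and held: "held \<kappa>' x"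
  shows "held \<kappa> x" "scount (facts \<kappa> (owner x)) x \<le> scount (facts \<kappa>' (owner x)) x"
    "CreatedUsing x z \<in> facts \<kappa> (owner x) \<Longrightarrow> CreatedUsing x z \<in> facts \<kappa>' (owner x)
      \<or> scount (facts \<kappa> (owner x)) x < scount (facts \<kappa>' (owner x)) x"
proof -
  note located = coherentD(1)[OF coherent]
  show "held \<kappa> x"
    using held step_transit[OF step located _ used] step_activates[OF step located _ _ used]
    unfolding held_def by blast
  \<comment> \<open>Held but inactive means in transit; then it was in transit before as well, and
    the phases exclude each other.\<close>
  have waiting: "\<not> active \<kappa> x" if "\<not> active \<kappa>' x"
  proof -
    have "transit \<kappa> x > 0"
      using held that step_transit[OF step located _ used] unfolding held_def by blast
    then show ?thesis using coherentD(2)[OF coherent, of x] by (auto simp: phase_def)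
  qed
  have s': "scount (facts \<kappa>' (owner x)) x = scount (facts \<kappa> (owner x)) x + of_bool (sent_along x ev)"
    if "active \<kappa>' x"
    using step_scount[OF step located, of x] step_send_release(2)[OF step located] that by blast
  show "scount (facts \<kappa> (owner x)) x \<le> scount (facts \<kappa>' (owner x)) x"
    using s' waiting inactive_scount[OF located, of x] by (cases "active \<kappa>' x") auto
  show "CreatedUsing x z \<in> facts \<kappa>' (owner x)
      \<or> scount (facts \<kappa> (owner x)) x < scount (facts \<kappa>' (owner x)) x"
    if created: "CreatedUsing x z \<in> facts \<kappa> (owner x)"
  proof (cases "sent_along x ev")
    case True
    have "active \<kappa>' x" using waiting locatedD(7)[OF located created] by blast
    then show ?thesis using s' True by simp
  next
    case False
    then show ?thesis using step_created_using[OF step located created] by blast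
  qed
qed

section \<open>Executions\<close>

definition used :: "(nat \<Rightarrow> ('t, 'a) config) \<Rightarrow> nat \<Rightarrow> 't set" where
  "used \<kappa> t = (\<Union>s \<in> {..t}. tokens (\<kappa> s))"

lemma used_mono: "s \<le> t \<Longrightarrow> used \<kappa> s \<subseteq> used \<kappa> t"
  unfolding used_def by force

lemma tokens_used: "tokens (\<kappa> t) \<subseteq> used \<kappa> t"
  unfolding used_def by blast

context
  fixes \<kappa> :: "nat \<Rightarrow> ('t, 'a) config" and e :: "nat \<Rightarrow> ('t, 'a) event" and N :: enat
  assumes execution: "execution \<kappa> e N"
begin

lemma execution_step: "enat t < N \<Longrightarrow> step (used \<kappa> t) (\<kappa> t) (e t) (\<kappa> (Suc t))"
  using execution unfolding execution_def steps_def used_def by blast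

lemma execution_invariant: "enat t \<le> N \<Longrightarrow> coherent (\<kappa> t) \<and> chained (\<kappa> t)"
proof (induction t)
  case 0
  then show ?case using execution initial_coherent unfolding execution_def by blast
next
  case (Suc t)
  then have t: "enat t < N" by (metis Suc_ile_eq)
  with Suc.IH have "coherent (\<kappa> t)" "chained (\<kappa> t)" by simp_all
  then show ?case
    using step_coherent[OF execution_step[OF t]] step_chained[OF execution_step[OF t]] tokens_used[of \<kappa> t]
    by blast
qed

lemma execution_mono:
  assumes "s \<le> t" "enat t \<le> N"
  shows "dom (actors (\<kappa> s)) \<subseteq> dom (actors (\<kappa> t)) \<and> externals (\<kappa> s) \<subseteq> externals (\<kappa> t)"
  using assms
proof (induction t rule: dec_induct)
  case (step t)
  then have t: "enat t < N" by (metis Suc_ile_eq)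
  then show ?case
    using step.IH[OF less_imp_le] step_mono(1,2)[OF execution_step[OF t]] by blast
qed simp

lemma execution_internal:
  assumes "A \<in> dom (actors (\<kappa> s))" "enat s \<le> N" "enat t \<le> N"
  shows "A \<notin> externals (\<kappa> t)"
proof -
  have N: "enat (max s t) \<le> N" using assms(2,3) by (simp add: max_def)
  have "A \<in> dom (actors (\<kappa> (max s t)))"
    using execution_mono[OF _ N, of s] assms(1) by auto
  moreover have "externals (\<kappa> t) \<subseteq> externals (\<kappa> (max s t))"
    using execution_mono[OF _ N, of t] by simp
  ultimately show ?thesis
    using locatedD(1)[OF coherentD(1)] execution_invariant[OF N] by blast
qed

lemma phase_antimono:
  assumes "s \<le> t" "enat t \<le> N" "token x \<in> used \<kappa> s"
  shows "phase (\<kappa> t) x \<le> phase (\<kappa> s) x"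
  using assms
proof (induction t rule: dec_induct)
  case (step t)
  then have t: "enat t < N" by (metis Suc_ile_eq)
  have "token x \<in> used \<kappa> t" using step.prems(2) used_mono[OF step.hyps(1), of \<kappa>] by blast
  moreover have "located (\<kappa> t)" using execution_invariant[OF less_imp_le[OF t]] coherentD(1) by blast
  ultimately have "phase (\<kappa> (Suc t)) x \<le> phase (\<kappa> t) x"
    using step_phase_used[OF execution_step[OF t]] by blast
  then show ?case using step.IH[OF less_imp_le[OF t] step.prems(2)] by simp
qed simp

text \<open>The induction runs backwards from \<open>t\<close>. The token being used at
  \<open>s\<close>, the refob was not introduced later. Below, the later time is that of a snapshot
  still to be taken by the owner.\<close>

lemma held_before:
  assumes "s \<le> t" "enat t \<le> N" "token x \<in> used \<kappa> s" "active (\<kappa> t) x"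
  shows "held (\<kappa> s) x \<and> scount (facts (\<kappa> s) (owner x)) x \<le> scount (facts (\<kappa> t) (owner x)) x
    \<and> (\<forall>z. CreatedUsing x z \<in> facts (\<kappa> s) (owner x) \<longrightarrow> CreatedUsing x z \<in> facts (\<kappa> t) (owner x)
        \<or> scount (facts (\<kappa> s) (owner x)) x < scount (facts (\<kappa> t) (owner x)) x)"
  using assms(1)
proof (induction rule: inc_induct)
  case base
  then show ?case using assms(4) by (simp add: held_def)
next
  case (step n)
  have "enat n < N" using step.hyps(2) assms(2) by (meson enat_ord_simps(2) order_less_le_trans)
  then have step_n: "step (used \<kappa> n) (\<kappa> n) (e n) (\<kappa> (Suc n))" and "coherent (\<kappa> n)"
    using execution_step execution_invariant by auto
  moreover have "token x \<in> used \<kappa> n" using assms(3) used_mono[OF step.hyps(1), of \<kappa>] by blast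
  moreover have "held (\<kappa> (Suc n)) x" using step.IH by blast
  ultimately have now: "held (\<kappa> n) x"
    "scount (facts (\<kappa> n) (owner x)) x \<le> scount (facts (\<kappa> (Suc n)) (owner x)) x"
    "\<And>z. CreatedUsing x z \<in> facts (\<kappa> n) (owner x) \<Longrightarrow> CreatedUsing x z \<in> facts (\<kappa> (Suc n)) (owner x)
      \<or> scount (facts (\<kappa> n) (owner x)) x < scount (facts (\<kappa> (Suc n)) (owner x)) x"
    using step_held by blast+
  moreover have "scount (facts (\<kappa> (Suc n)) (owner x)) x \<le> scount (facts (\<kappa> t) (owner x)) x"
    using step.IH by blast
  ultimately show ?case
    using step.IH by (meson le_trans less_le_trans le_less_trans)
qed

end


section \<open>Finalized snapshots\<close>

text \<open>Compaction is the only event that changes the knowledge of an idle actor without messages.\<close>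

definition pruned :: "('t, 'a) knowledge \<Rightarrow> ('t, 'a) knowledge \<Rightarrow> bool" where
  "pruned \<Phi> \<Psi> \<longleftrightarrow> \<Psi> \<subseteq> \<Phi> \<and> (\<forall>\<phi> \<in> \<Phi> - \<Psi>. \<exists>x. Released x \<in> \<Phi>
     \<and> (\<phi> = Created x \<or> \<phi> = Released x \<or> (\<exists>n. \<phi> = RecvCount x n)))"

text \<open>\<open>\<tau>\<close> gives the time of each actor's snapshot. Actors whose snapshot is
  still to come are unconstrained, so an induction on time can pass through snapshots taken at
  different moments.\<close>

definition quiet ::
  "(nat \<Rightarrow> ('t, 'a) config) \<Rightarrow> ('t, 'a) snapshots \<Rightarrow> ('a \<Rightarrow> nat) \<Rightarrow> nat \<Rightarrow> bool" where
  "quiet \<kappa> Q \<tau> t \<longleftrightarrow> (\<forall>A \<Phi>. Q A = Some \<Phi> \<and> \<tau> A \<le> t \<longrightarrow>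
     (\<exists>\<Psi>. actors (\<kappa> t) A = Some (IdleWith \<Psi>) \<and> pruned \<Phi> \<Psi>))"

lemma pruned_counts:
  assumes "pruned \<Phi> \<Psi>"
  shows "scount \<Psi> x = scount \<Phi> x" "Released x \<notin> \<Phi> \<Longrightarrow> rcount \<Psi> x = rcount \<Phi> x"
  using assms unfolding pruned_def by (blast intro!: count_cong)+

context
  fixes \<kappa> :: "nat \<Rightarrow> ('t, 'a) config" and e :: "nat \<Rightarrow> ('t, 'a) event" and N :: enat and t\<^sub>f :: nat
    and Q :: "('t, 'a) snapshots" and \<tau> :: "'a \<Rightarrow> nat"
  assumes execution: "execution \<kappa> e N" and t\<^sub>f: "enat t\<^sub>f \<le> N" and finalized: "finalized Q"
    and taken: "\<And>A \<Phi>. Q A = Some \<Phi> \<Longrightarrow> \<tau> A \<le> t\<^sub>f \<and> enat (\<tau> A) < N \<and> e (\<tau> A) = Snapshot A \<Phi>"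
begin

lemma within: "t \<le> t\<^sub>f \<Longrightarrow> enat t \<le> N"
  using t\<^sub>f by (meson enat_ord_simps(1) order_trans)

lemma coherent_at: "t \<le> t\<^sub>f \<Longrightarrow> coherent (\<kappa> t)" and chained_at: "t \<le> t\<^sub>f \<Longrightarrow> chained (\<kappa> t)"
  using execution_invariant[OF execution within] by auto

lemma snapshot_state:
  assumes "Q A = Some \<Phi>"
  shows "actors (\<kappa> (\<tau> A)) A = Some (IdleWith \<Phi>)"
proof -
  have "step (used \<kappa> (\<tau> A)) (\<kappa> (\<tau> A)) (Snapshot A \<Phi>) (\<kappa> (Suc (\<tau> A)))"
    using execution_step[OF execution, of "\<tau> A"] taken[OF assms] by simp
  then show ?thesis by (cases rule: step.cases) auto
qed

lemma snapshot_facts: "Q A = Some \<Phi> \<Longrightarrow> facts (\<kappa> (\<tau> A)) A = \<Phi>"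
  using snapshot_state by (simp add: facts_Some)

lemma snapshot_located: "Q A = Some \<Phi> \<Longrightarrow> located (\<kappa> (\<tau> A))"
  using coherent_at coherentD(1) taken by blast

lemma snapshot_unique: "Q A = Some \<Phi> \<Longrightarrow> counts_unique \<Phi>"
  using locatedD(5)[OF snapshot_located] snapshot_facts by metis

lemma snapshot_internal:
  assumes "Q A = Some \<Phi>" "t \<le> t\<^sub>f"
  shows "A \<notin> externals (\<kappa> t)"
  using execution_internal[OF execution, of A "\<tau> A" t] snapshot_state[OF assms(1)] within
    taken[OF assms(1)] assms(2) by blast

text \<open>A \<open>Released\<close> fact means phase 0 and an internal owner. Phases of used
  tokens never rise and internal actors never become external, so \<open>x\<close> would not be live
  at \<open>t\<close>.\<close>

lemma not_released:
  assumes "Q A = Some \<Phi>" "\<tau> A \<le> t" "t \<le> t\<^sub>f" "live (\<kappa> t) x"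
  shows "Released x \<notin> \<Phi>"
proof
  assume "Released x \<in> \<Phi>"
  then have released: "Released x \<in> facts (\<kappa> (\<tau> A)) A" using snapshot_facts[OF assms(1)] by simp
  note ok = locatedD(3)[OF snapshot_located[OF assms(1)] released]
  have "token x \<in> used \<kappa> (\<tau> A)"
    using fresh(1)[of x "\<kappa> (\<tau> A)", OF _ released] tokens_used[of \<kappa> "\<tau> A"] by fastforce
  moreover have "phase (\<kappa> (\<tau> A)) x = 0"
    using coherentD(3)[OF coherent_at] released ok taken[OF assms(1)] by simp
  ultimately have "phase (\<kappa> t) x = 0"
    using phase_antimono[OF execution assms(2) within[OF assms(3)]] by fastforce
  moreover have "owner x \<notin> externals (\<kappa> t)"
    using execution_internal[OF execution, of "owner x" "\<tau> A" t] ok within assms taken[OF assms(1)]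
    by simp
  ultimately show False using assms(4) by (simp add: live_def)
qed

context
  fixes t :: nat
  assumes t: "t \<le> t\<^sub>f" and quiet: "quiet \<kappa> Q \<tau> t"
begin

lemma quiet_facts:
  assumes "Q A = Some \<Phi>" "\<tau> A \<le> t"
  shows "pruned \<Phi> (facts (\<kappa> t) A)"
  using quiet assms facts_Some(2) unfolding quiet_def by metis

text \<open>The target's snapshot is in the past and its receive count is unchanged since; the
  owner's snapshot may lie in the past or in the future, and the two cases are treated
  separately.\<close>

lemma settled:
  assumes B: "Q (target x) = Some \<Phi>\<^sub>B" "\<tau> (target x) \<le> t"
    and unreleased: "Q \<turnstile>\<^sub>Q Unreleased x"
    and live: "live (\<kappa> t) x" and token: "token x \<in> used \<kappa> t"
  obtains \<Phi> where "Q (owner x) = Some \<Phi>" "inflight (\<kappa> t) x = 0" "releasing (\<kappa> t) x = 0"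
    "\<And>z. CreatedUsing x z \<in> facts (\<kappa> t) (owner x) \<Longrightarrow> CreatedUsing x z \<in> \<Phi>"
proof -
  have "\<exists>\<Phi>. Q (owner x) = Some \<Phi> \<and> \<Phi> \<turnstile> Activated x"
    using finalized unreleased B(1) unfolding finalized_def closed_snapshots_def by blast
  then obtain \<Phi> where A: "Q (owner x) = Some \<Phi>" and activated: "Activated x \<in> \<Phi>"
    by (auto simp: entails_simps)
  have "appears_blocked Q (target x)"
    using finalized B(1) unfolding finalized_def by blast
  then obtain n where "\<Phi> \<turnstile> SentCount x n" "\<Phi>\<^sub>B \<turnstile> RecvCount x n"
    using unreleased A B(1) unfolding appears_blocked_def by fastforce
  then have n: "scount \<Phi> x = n" "rcount \<Phi>\<^sub>B x = n"
    using entails_count snapshot_unique A B(1) by metis+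
  have received: "rcount (facts (\<kappa> t) (target x)) x = n"
    using pruned_counts(2)[OF quiet_facts[OF B]] not_released[OF B t live] n(2) by simp
  note coherent = coherent_at[OF t]
  have balanced: "balanced (\<kappa> t) x"
    using coherentD(4)[OF coherent] snapshot_internal[OF B(1) t] by blast
  have phase: "transit (\<kappa> t) x + of_bool (active (\<kappa> t) x) + releasing (\<kappa> t) x \<le> 1"
    using coherentD(2)[OF coherent, of x] by (simp add: phase_def)
  show thesis
  proof (cases "\<tau> (owner x) \<le> t")
    case True
    \<comment> \<open>The owner has been idle since its snapshot, so its send count is still
      \<open>n\<close>, equal to the receive count.\<close>
    note pruned = quiet_facts[OF A True]
    have "active (\<kappa> t) x" using pruned activated unfolding pruned_def by blast
    moreover have "scount (facts (\<kappa> t) (owner x)) x = n"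
      using pruned_counts(1)[OF pruned] n(1) by simp
    ultimately show thesis
      using that[OF A] balanced received phase pruned by (auto simp: balanced_def pruned_def)
  next
    case False
    \<comment> \<open>The owner's snapshot is still to come. Looking back from it gives
      \<open>s \<le> n\<close>; if the refob is active at \<open>t\<close>, balance gives
      \<open>s = n + inflight (\<kappa> t) x\<close>. So nothing is in flight, and since
      \<open>s < n\<close> fails, every \<open>CreatedUsing\<close> fact survives until the
      snapshot.\<close>
    define s where "s = scount (facts (\<kappa> t) (owner x)) x"
    have "active (\<kappa> (\<tau> (owner x))) x" using activated snapshot_facts[OF A] by simp
    then have before: "held (\<kappa> t) x" "s \<le> n"
      "\<And>z. CreatedUsing x z \<in> facts (\<kappa> t) (owner x) \<Longrightarrow> CreatedUsing x z \<in> \<Phi> \<or> s < n"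
      using held_before[OF execution, of t "\<tau> (owner x)" x] False taken[OF A] token
        snapshot_facts[OF A] n(1) less_imp_le unfolding s_def by auto
    show thesis
    proof (cases "active (\<kappa> t) x")
      case True
      then have "s = n + inflight (\<kappa> t) x"
        using balanced received unfolding balanced_def s_def by simp
      then show thesis using that[OF A] before phase True by auto
    next
      case inactive: False
      \<comment> \<open>The refob has not reached its owner, so nothing has been sent along it or
        created with it.\<close>
      then have "transit (\<kappa> t) x > 0" using before(1) by (simp add: held_def)
      then have "releasing (\<kappa> t) x = 0" using phase by simp
      moreover from this have "inflight (\<kappa> t) x = 0"
        using balanced inactive unfolding balanced_def by metis
      ultimately show thesis
        using that[OF A] inactive locatedD(7)[OF coherentD(1)[OF coherent]] by blast
    qed
  qed
qed

lemma chain_unreleased: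
  assumes "chain (\<kappa> t) x" "target x = B" "B \<in> dom Q" "\<tau> B \<le> t"
  shows "Q \<turnstile>\<^sub>Q Unreleased x"
  using assms
proof induction
  case (created x)
  then obtain \<Phi> where \<Phi>: "Q B = Some \<Phi>" by blast
  then have "Created x \<in> \<Phi>"
    using quiet_facts[OF \<Phi> created.prems(3)] created unfolding pruned_def by blast
  moreover have "Released x \<notin> \<Phi>"
    using not_released[OF \<Phi> created.prems(3) t created.hyps(1)] .
  ultimately show ?case
    using \<Phi> unfolding snapshots_entail_def by (metis entails.member entails.unreleased ranI)
next
  case (link y x)
  note located = coherentD(1)[OF coherent_at[OF t]]
  have y: "target y = B" using link_target[OF located link.hyps(2)] link.prems(1) by simp
  obtain \<Phi>\<^sub>B where \<Phi>\<^sub>B: "Q B = Some \<Phi>\<^sub>B" using link.prems(2) by blast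
  have "token y \<in> used \<kappa> t" using link_token(1)[OF link.hyps(2)] tokens_used[of \<kappa> t] by blast
  then obtain \<Phi> where \<Phi>: "Q (owner y) = Some \<Phi>" "inflight (\<kappa> t) y = 0"
    "\<And>z. CreatedUsing y z \<in> facts (\<kappa> t) (owner y) \<Longrightarrow> CreatedUsing y z \<in> \<Phi>"
    using settled[of y \<Phi>\<^sub>B] \<Phi>\<^sub>B y link.IH link.prems chain_live[OF link.hyps(1)] by auto
  have "InfoMsg y x C \<notin># msgs (\<kappa> t) A" for A C
    using \<Phi>(2) locatedD(4)[OF located, of "InfoMsg y x C" A] by (fastforce simp: pending_eq_0_iff)
  then have "CreatedUsing y x \<in> \<Phi>" using link.hyps(2) \<Phi>(3) unfolding link_def by blast
  \<comment> \<open>Here \<Phi> belongs to the owner of \<open>y\<close>. \<open>Released\<close>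
    facts are stored only at the target, so that owner would be \<open>B\<close> itself, whose
    snapshot \<open>not_released\<close> covers.\<close>
  moreover have "Released x \<notin> \<Phi>"
  proof
    assume "Released x \<in> \<Phi>"
    then have "owner y = B"
      using locatedD(3)[OF snapshot_located[OF \<Phi>(1)]] snapshot_facts[OF \<Phi>(1)] link.prems(1) by fastforce
    then show False
      using not_released[OF \<Phi>(1) _ t link.hyps(3)] link.prems(3) \<open>Released x \<in> \<Phi>\<close> by simp
  qed
  ultimately show ?case
    using \<Phi>(1) unfolding snapshots_entail_def
    by (metis entails.member entails.created entails.unreleased ranI)
qed

lemma chain_settled:
  assumes x: "chain (\<kappa> t) x" and B: "target x = B" "B \<in> dom Q" "\<tau> B \<le> t"
  shows "owner x \<in> dom Q" "inflight (\<kappa> t) x = 0" "releasing (\<kappa> t) x = 0"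
proof -
  obtain \<Phi>\<^sub>B where "Q (target x) = Some \<Phi>\<^sub>B" using B by blast
  moreover have "\<tau> (target x) \<le> t" using B by simp
  moreover have "token x \<in> used \<kappa> t" using chain_token[OF x] tokens_used[of \<kappa> t] by blast
  ultimately obtain \<Phi> where "Q (owner x) = Some \<Phi>" "inflight (\<kappa> t) x = 0" "releasing (\<kappa> t) x = 0"
    using settled[OF _ _ chain_unreleased[OF assms] chain_live[OF x]] by metis
  then show "owner x \<in> dom Q" "inflight (\<kappa> t) x = 0" "releasing (\<kappa> t) x = 0" by blast+
qed

lemma not_receptionist:
  assumes "B \<in> dom Q" "\<tau> B \<le> t"
  shows "B \<notin> receptionists (\<kappa> t)"
proof
  assume "B \<in> receptionists (\<kappa> t)"
  then obtain x where x: "target x = B" "owner x \<in> externals (\<kappa> t)" "chain (\<kappa> t) x"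
    using chained_at[OF t] unfolding chained_def by blast
  then show False
    using chain_settled(1)[OF x(3,1) assms] snapshot_internal[OF _ t] by blast
qed

lemma refob_settled:
  assumes "target x = B" "B \<in> dom Q" "\<tau> B \<le> t" "phase (\<kappa> t) x > 0"
  shows "owner x \<in> dom Q" "inflight (\<kappa> t) x = 0" "releasing (\<kappa> t) x = 0"
proof -
  have "B \<notin> externals (\<kappa> t)" using snapshot_internal[OF _ t] assms(2) by blast
  then have "chain (\<kappa> t) x"
    using chained_at[OF t] assms not_receptionist unfolding chained_def by blast
  then show "owner x \<in> dom Q" "inflight (\<kappa> t) x = 0" "releasing (\<kappa> t) x = 0"
    using chain_settled assms(1-3) by blast+
qed

lemma no_messages:
  assumes "B \<in> dom Q" "\<tau> B \<le> t"
  shows "msgs (\<kappa> t) B = {#}"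
proof (rule ccontr)
  assume "msgs (\<kappa> t) B \<noteq> {#}"
  then obtain m where m: "m \<in># msgs (\<kappa> t) B" by blast
  note coherent = coherent_at[OF t]
  note ok = locatedD(4)[OF coherentD(1)[OF coherent] m]
  have external: "B \<notin> externals (\<kappa> t)" using snapshot_internal[OF _ t] assms(1) by blast
  \<comment> \<open>Balance leaves nothing in flight along a refob that is neither active nor being
    released, so either kind of message forces positive phase; but refobs of positive phase towards
    \<open>B\<close> are settled.\<close>
  have idle: False if "along x m \<or> releases x m" "target x = B" for x
  proof -
    have "inflight (\<kappa> t) x > 0 \<or> releasing (\<kappa> t) x > 0"
      using that pending_pos[OF m, of "along x"] pending_pos[OF m, of "releases x"] by auto
    moreover have "balanced (\<kappa> t) x"
      using coherentD(4)[OF coherent] external that(2) by simp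
    then have "active (\<kappa> t) x \<or> releasing (\<kappa> t) x \<noteq> 0 \<or> inflight (\<kappa> t) x = 0"
      unfolding balanced_def by metis
    ultimately have "phase (\<kappa> t) x > 0" by (auto simp: phase_def)
    then show False
      using refob_settled(2,3)[OF that(2) assms] \<open>inflight (\<kappa> t) x > 0 \<or> releasing (\<kappa> t) x > 0\<close> by simp
  qed
  show False
  proof (cases m)
    case (App w R)
    then show ?thesis using ok not_receptionist[OF assms] idle[of "the w"] by (cases w) auto
  next
    case (InfoMsg y z A)
    then show ?thesis using ok idle[of y] by simp
  next
    case (ReleaseMsg x n)
    then show ?thesis using ok idle[of x] by simp
  qed
qed

end

lemma quiet_Suc:
  assumes t: "Suc t \<le> t\<^sub>f" and quiet: "quiet \<kappa> Q \<tau> t"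
  shows "quiet \<kappa> Q \<tau> (Suc t)"
  unfolding quiet_def
proof (intro allI impI, elim conjE)
  fix A \<Phi>
  assume A: "Q A = Some \<Phi>" and "\<tau> A \<le> Suc t"
  show "\<exists>\<Psi>. actors (\<kappa> (Suc t)) A = Some (IdleWith \<Psi>) \<and> pruned \<Phi> \<Psi>"
  proof (cases "\<tau> A \<le> t")
    case False
    \<comment> \<open>The snapshot is taken at time \<open>Suc t\<close> exactly, so nothing has
      been pruned yet.\<close>
    then show ?thesis
      using snapshot_state[OF A] \<open>\<tau> A \<le> Suc t\<close> by (simp add: le_Suc_eq pruned_def)
  next
    case True
    then obtain \<Psi> where \<Psi>: "actors (\<kappa> t) A = Some (IdleWith \<Psi>)" "pruned \<Phi> \<Psi>"
      using quiet A unfolding quiet_def by blast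
    have no_msgs: "msgs (\<kappa> t) A = {#}"
      using no_messages[OF _ quiet _ True] t A by (simp add: domI)
    have "enat t < N" using within[OF t] by (metis Suc_ile_eq)
    from execution_step[OF execution this] show ?thesis
    proof (cases rule: step.cases)
      case (compaction C \<Theta> x)
      then show ?thesis
        using \<Psi> by (cases "C = A") (auto simp: pruned_def)
    qed (use \<Psi> no_msgs in auto)
  qed
qed

lemma quiet_until: "t \<le> t\<^sub>f \<Longrightarrow> quiet \<kappa> Q \<tau> t"
proof (induction t)
  case 0
  then show ?case using snapshot_state by (fastforce simp: quiet_def pruned_def)
qed (simp add: quiet_Suc)

end

section \<open>Permanence of termination\<close>

text \<open>This invariant does not mention tokens: continuations may reuse those that have disappeared from
  the configuration.\<close>

definition sealed :: "'a set \<Rightarrow> ('t, 'a) config \<Rightarrow> bool" where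
  "sealed S \<kappa> \<longleftrightarrow> (\<forall>A \<in> S. (\<exists>\<Phi>. actors \<kappa> A = Some (IdleWith \<Phi>)) \<and> msgs \<kappa> A = {#} \<and> A \<notin> receptionists \<kappa>)
     \<and> (\<forall>A x. A \<notin> S \<and> Activated x \<in> facts \<kappa> A \<longrightarrow> target x \<notin> S)
     \<and> (\<forall>A y z. A \<notin> S \<and> CreatedUsing y z \<in> facts \<kappa> A \<longrightarrow> target y \<notin> S)
     \<and> (\<forall>A w R. App w R \<in># msgs \<kappa> A \<longrightarrow> target ` R \<inter> S = {})"

lemma sealedD:
  assumes "sealed S \<kappa>"
  shows "A \<in> S \<Longrightarrow> \<exists>\<Phi>. actors \<kappa> A = Some (IdleWith \<Phi>)" "A \<in> S \<Longrightarrow> msgs \<kappa> A = {#}"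
    "A \<in> S \<Longrightarrow> A \<notin> receptionists \<kappa>"
    "Activated x \<in> facts \<kappa> A \<Longrightarrow> A \<notin> S \<Longrightarrow> target x \<notin> S"
    "CreatedUsing y z \<in> facts \<kappa> A \<Longrightarrow> A \<notin> S \<Longrightarrow> target y \<notin> S"
    "App w R \<in># msgs \<kappa> A \<Longrightarrow> x \<in> R \<Longrightarrow> target x \<notin> S"
  using assms unfolding sealed_def by (simp_all, blast+)

text \<open>Actors in \<open>S\<close> are idle, so only the others send, and they have no refob
  towards \<open>S\<close>. New refobs target what an active refob outside \<open>S\<close> targets,
  a spawned actor, or, when coming from outside, a receptionist or external actor.\<close>

lemma step_sealed:
  assumes step: "step U \<kappa> ev \<kappa>'" and sealed: "sealed S \<kappa>"
  shows "sealed S \<kappa>'"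
proof -
  note S = sealedD(1-3)[OF sealed] and activated = sealedD(4)[OF sealed]
    and created_using = sealedD(5)[OF sealed] and app = sealedD(6)[OF sealed]
  have busy: "A \<notin> S" if "actors \<kappa> A = Some (BusyWith \<Phi>)" for A \<Phi>
    using S(1)[of A] that by auto
  have activated_busy: "target x \<notin> S" if "actors \<kappa> A = Some (BusyWith \<Phi>)" "Activated x \<in> \<Phi>" for A \<Phi> x
    using activated[of x A] busy that by (auto simp: facts_Some)
  have created_using_busy: "target y \<notin> S"
    if "actors \<kappa> A = Some (BusyWith \<Phi>)" "CreatedUsing y z \<in> \<Phi>" for A \<Phi> y z
    using created_using[of y z A] busy that by (auto simp: facts_Some)
  have receives: "A \<notin> S" if "m \<in># msgs \<kappa> A" for A m
    using S(2)[of A] that by auto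
  have internal: "A \<in> dom (actors \<kappa>)" if "A \<in> S" for A
    using S(1)[OF that] by blast
  have "\<exists>\<Phi>. actors \<kappa>' A = Some (IdleWith \<Phi>)" if "A \<in> S" for A
    using step S(1)[OF that] busy receives that internal[OF that]
    by (cases rule: step.cases) auto
  moreover have "msgs \<kappa>' A = {#}" if "A \<in> S" for A
    using step
  proof (cases rule: step.cases)
    case (send B \<Phi> x yzs)
    then have "target x \<notin> S" using activated_busy by (simp add: entails_simps)
    then show ?thesis using send S(2) that by auto
  next
    case (send_info B \<Phi> y z)
    then have "target y \<notin> S" using created_using_busy by simp
    then show ?thesis using send_info S(2) that by auto
  next
    case (send_release B \<Phi> x n)
    then have "target x \<notin> S" using activated_busy by simp
    then show ?thesis using send_release S(2) that by auto
  next
    case ("in" B R)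
    then show ?thesis using S(2,3) that by auto
  qed (use S(2) that in auto)
  moreover have "A \<notin> receptionists \<kappa>'" if "A \<in> S" for A
    using step
  proof (cases rule: step.cases)
    case (out B w R)
    then show ?thesis using app[OF out(4)] S(3) that by auto
  qed (use S(3) that in auto)
  moreover have "target x \<notin> S" if x: "Activated x \<in> facts \<kappa>' A" "A \<notin> S" for A x
  proof -
    have "Activated x \<in> facts \<kappa> A \<or> target x \<notin> S"
      using step
    proof (cases rule: step.cases)
      case (spawn B \<Phi> C y z)
      \<comment> \<open>Both new refobs target the spawned actor, whose name is new, whereas
        \<open>S\<close> consists of existing actors.\<close>
      then have "target y \<notin> S" "target z \<notin> S" using internal by auto
      then show ?thesis using spawn x(1) by (auto simp: facts_Some(1,2) split: if_splits)
    next
      case (receive B \<Phi> w R)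
      then show ?thesis
        using x(1) app[OF receive(4)] by (auto simp: facts_Some split: if_splits option.splits)
    qed (use x(1) in \<open>auto simp: facts_Some split: if_splits\<close>)
    then show ?thesis using activated x(2) by blast
  qed
  moreover have "target y \<notin> S" if y: "CreatedUsing y z \<in> facts \<kappa>' A" "A \<notin> S" for A y z
  proof -
    have "CreatedUsing y z \<in> facts \<kappa> A \<or> target y \<notin> S"
      using step
    proof (cases rule: step.cases)
      case (spawn B \<Phi> C u v)
      then show ?thesis using y(1) by (auto simp: facts_Some(1,2) split: if_splits)
    next
      case (send B \<Phi> x yzs)
      show ?thesis
      proof (cases "(y, z) \<in> set yzs")
        case True
        then show ?thesis using send activated_busy[OF send(3), of y] by (auto simp: entails_simps)
      next
        case False
        then show ?thesis using send y(1) by (auto simp: facts_Some split: if_splits)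
      qed
    qed (use y(1) in \<open>auto simp: facts_Some split: if_splits option.splits\<close>)
    then show ?thesis using created_using y(2) by blast
  qed
  moreover have "target ` R \<inter> S = {}" if "App w R \<in># msgs \<kappa>' A" for A w R
  proof -
    have "target x \<notin> S" if "x \<in> R" for x
      using step
    proof (cases rule: step.cases)
      case (send B \<Phi> y yzs)
      show ?thesis
      proof (cases "App w R \<in># msgs \<kappa> A")
        case False
        then have "R = snd ` set yzs"
          using send \<open>App w R \<in># msgs \<kappa>' A\<close> by (auto split: if_splits)
        then obtain u where "(u, x) \<in> set yzs" using \<open>x \<in> R\<close> by auto
        then show ?thesis
          using send activated_busy[OF send(3), of u] by (auto simp: entails_simps)
      qed (use app that in blast)
    next
      case ("in" B R')
      \<comment> \<open>An incoming refob targets a receptionist or an actor that is not internal,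
        and \<open>S\<close> contains neither.\<close>
      then have "target x \<notin> S" if "x \<in> R'" using S(3) internal that by blast
      then show ?thesis
        using "in" \<open>App w R \<in># msgs \<kappa>' A\<close> \<open>x \<in> R\<close> app[of w R A x] by (auto split: if_splits)
    qed (use \<open>App w R \<in># msgs \<kappa>' A\<close> app[of w R A x] that in \<open>auto split: if_splits dest: in_diffD\<close>)
    then show ?thesis by blast
  qed
  ultimately show ?thesis unfolding sealed_def by blast
qed

lemma sealed_terminated:
  assumes "sealed S \<kappa>" "A \<in> S"
  shows "terminated A \<kappa>"
proof -
  have "sealed S (\<kappa>' n)" if "\<kappa>' 0 = \<kappa>" "steps \<kappa>' e (enat n)" for \<kappa>' e n
  proof -
    have "sealed S (\<kappa>' m)" if "m \<le> n" for m
      using that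
    proof (induction m)
      case 0
      then show ?case using assms(1) \<open>\<kappa>' 0 = \<kappa>\<close> by simp
    next
      case (Suc m)
      then show ?case
        using step_sealed \<open>steps \<kappa>' e (enat n)\<close> unfolding steps_def
        by (metis Suc_le_eq enat_ord_simps(2) less_imp_le)
    qed
    then show ?thesis by simp
  qed
  then show ?thesis
    using assms unfolding terminated_def potentially_receives_def sealed_def by metis
qed

section \<open>The snapshot actors are sealed at time \<open>t\<^sub>f\<close>\<close>

theorem mainTheorem3:
  fixes \<kappa> :: "nat \<Rightarrow> ('t, 'a) config" and e :: "nat \<Rightarrow> ('t, 'a) event"
    and N :: enat and t\<^sub>f :: nat and Q :: "('t, 'a) snapshots"
  assumes "execution \<kappa> e N"
    and "enat t\<^sub>f \<le> N"
    and "finalized Q"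
    and "snapshots_taken_by e N t\<^sub>f Q"
    and "A \<in> dom Q"
  shows "terminated A (\<kappa> t\<^sub>f)"
proof -
  \<comment> \<open>An actor may record the same snapshot several times; any one time up to
    \<open>t\<^sub>f\<close> will do.\<close>
  have "\<exists>t. \<forall>\<Phi>. Q B = Some \<Phi> \<longrightarrow> t \<le> t\<^sub>f \<and> enat t < N \<and> e t = Snapshot B \<Phi>" for B
    using assms(4) unfolding snapshots_taken_by_def by (cases "Q B") auto
  then obtain \<tau> where \<tau>: "\<And>B \<Phi>. Q B = Some \<Phi> \<Longrightarrow> \<tau> B \<le> t\<^sub>f \<and> enat (\<tau> B) < N \<and> e (\<tau> B) = Snapshot B \<Phi>"
    by metis
  note run = assms(1-3) \<tau>
  have quiet: "quiet \<kappa> Q \<tau> t\<^sub>f" using quiet_until[OF run] by blast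
  have before: "\<tau> B \<le> t\<^sub>f" if "B \<in> dom Q" for B using \<tau> that by blast
  note coherent = coherent_at[OF run order_refl]
  note located = coherentD(1)[OF coherent]
  have no_msgs: "msgs (\<kappa> t\<^sub>f) B = {#}" if "B \<in> dom Q" for B
    using no_messages[OF run order_refl quiet that before[OF that]] .
  have owner: "owner x \<in> dom Q" if "phase (\<kappa> t\<^sub>f) x > 0" "target x \<in> dom Q" for x
    using refob_settled(1)[OF run order_refl quiet refl that(2) before[OF that(2)] that(1)] .
  have "sealed (dom Q) (\<kappa> t\<^sub>f)"
    unfolding sealed_def
  proof (intro conjI ballI allI impI; (elim conjE)?)
    fix B
    assume B: "B \<in> dom Q"
    show "\<exists>\<Phi>. actors (\<kappa> t\<^sub>f) B = Some (IdleWith \<Phi>)"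
      using quiet B before[OF B] unfolding quiet_def by blast
    show "msgs (\<kappa> t\<^sub>f) B = {#}" using no_msgs[OF B] .
    show "B \<notin> receptionists (\<kappa> t\<^sub>f)"
      using not_receptionist[OF run order_refl quiet B before[OF B]] .
  next
    fix B x
    assume "B \<notin> dom Q" "Activated x \<in> facts (\<kappa> t\<^sub>f) B"
    then show "target x \<notin> dom Q"
      using owner[of x] locatedD(3)[OF located, of "Activated x" B] by (auto simp: phase_def)
  next
    fix B y z
    assume B: "B \<notin> dom Q" "CreatedUsing y z \<in> facts (\<kappa> t\<^sub>f) B"
    then have "owner y = B" using locatedD(3)[OF located] by fastforce
    then show "target y \<notin> dom Q"
      using B owner[of y] locatedD(7)[OF located, of y z] by (auto simp: phase_def)
  next
    fix B w R
    assume message: "App w R \<in># msgs (\<kappa> t\<^sub>f) B"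
    \<comment> \<open>The carried refob has positive phase and the recipient as owner. If it
      targeted a snapshot actor, the recipient would be one too, but those have no messages.\<close>
    have "target x \<notin> dom Q" if "x \<in> R" for x
    proof
      assume "target x \<in> dom Q"
      moreover have "owner x = B" using locatedD(4)[OF located message] that by simp
      moreover have "phase (\<kappa> t\<^sub>f) x > 0"
        using pending_pos[OF message, of "carries x"] that \<open>owner x = B\<close> by (simp add: phase_def)
      ultimately show False using owner[of x] no_msgs[of B] message by simp
    qed
    then show "target ` R \<inter> dom Q = {}" by blast
  qed
  then show ?thesis using assms(5) by (rule sealed_terminated)
qed

end
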